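(* Let $G$ be a group and let $n,m\ge 0$ be integers. The following are equivalent: (1) $G$ admits a presentation of the form $$\Big\langle a_1,\dots,a_n,c_1,\dots,c_m \ \Big|\ [a_i,a_j]=\prod_{t=1}^m c_t^{\lambda_t^{ij}}\ (1\le i<j\le n),\ [a_i,c_j]=[c_k,c_r]=1 \text{ for all } i,j,k,r\Big\rangle$$ for some integers $\lambda_t^{ij}$. (2) $G$ is a finitely generated, torsion-free, $2$-step nilpotent group satisfying $\mathrm{rank}(G/Z(G))+\mathrm{rank}(Z(G))=n+m$ and $\mathrm{rank}(G')\le m\le \mathrm{rank}(Z(G))$. Consequently, $G$ is finitely generated, torsion-free and $2$-step nilpotent if and only if it admits a presentation of the form in (1) for some $n,m\ge0$.
   Context: Commutators: $[g,h]=g^{-1}h^{-1}gh$. A group is $2$-step nilpotent if all commutators lie in its center (this includes abelian groups). The rank of a finitely generated abelian group is the minimum cardinality of a generating set. *)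

theory Defs
  imports "HOL-Algebra.Algebra"
begin

definition comm :: "('a, 'b) monoid_scheme \<Rightarrow> 'a \<Rightarrow> 'a \<Rightarrow> 'a" where
  "comm G g h = inv\<^bsub>G\<^esub> g \<otimes>\<^bsub>G\<^esub> inv\<^bsub>G\<^esub> h \<otimes>\<^bsub>G\<^esub> g \<otimes>\<^bsub>G\<^esub> h"

definition center :: "('a, 'b) monoid_scheme \<Rightarrow> 'a set" where
  "center G = {z \<in> carrier G. \<forall>g \<in> carrier G. z \<otimes>\<^bsub>G\<^esub> g = g \<otimes>\<^bsub>G\<^esub> z}"

definition derived_subgroup :: "('a, 'b) monoid_scheme \<Rightarrow> 'a set" where
  "derived_subgroup G = generate G {comm G g h | g h. g \<in> carrier G \<and> h \<in> carrier G}"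

definition fin_gen :: "('a, 'b) monoid_scheme \<Rightarrow> bool" where
  "fin_gen G \<longleftrightarrow> (\<exists>S. finite S \<and> S \<subseteq> carrier G \<and> generate G S = carrier G)"

definition torsion_free :: "('a, 'b) monoid_scheme \<Rightarrow> bool" where
  "torsion_free G \<longleftrightarrow>
     (\<forall>x \<in> carrier G. \<forall>k::nat. k > 0 \<longrightarrow> x [^]\<^bsub>G\<^esub> k = \<one>\<^bsub>G\<^esub> \<longrightarrow> x = \<one>\<^bsub>G\<^esub>)"

text \<open>2-step nilpotent: all commutators lie in the center (includes abelian groups).\<close>
definition two_step_nilpotent :: "('a, 'b) monoid_scheme \<Rightarrow> bool" where
  "two_step_nilpotent G \<longleftrightarrow>
     (\<forall>g \<in> carrier G. \<forall>h \<in> carrier G. comm G g h \<in> center G)"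

definition grp_rank :: "('a, 'b) monoid_scheme \<Rightarrow> nat" where
  "grp_rank G = (LEAST k. \<exists>S. finite S \<and> S \<subseteq> carrier G \<and> card S = k \<and> generate G S = carrier G)"

text \<open>Words over a generator type: letters (x, True) = x, (x, False) = x^-1.\<close>
type_synonym 'g word = "('g \<times> bool) list"

definition words :: "'g set \<Rightarrow> 'g word set" where
  "words S = lists (S \<times> UNIV)"

fun eval_word :: "('a, 'b) monoid_scheme \<Rightarrow> ('g \<Rightarrow> 'a) \<Rightarrow> 'g word \<Rightarrow> 'a" where
  "eval_word G f [] = \<one>\<^bsub>G\<^esub>"
| "eval_word G f ((x, b) # w) =
     (if b then f x else inv\<^bsub>G\<^esub> (f x)) \<otimes>\<^bsub>G\<^esub> eval_word G f w"

inductive word_step :: "'g set \<Rightarrow> ('g word \<times> 'g word) set \<Rightarrow> 'g word \<Rightarrow> 'g word \<Rightarrow> bool"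
  for S R where
  cancel: "x \<in> S \<Longrightarrow> word_step S R (u @ [(x, b), (x, \<not> b)] @ v) (u @ v)"
| rel: "(l, r) \<in> R \<Longrightarrow> word_step S R (u @ l @ v) (u @ r @ v)"

definition word_equiv :: "'g set \<Rightarrow> ('g word \<times> 'g word) set \<Rightarrow> 'g word \<Rightarrow> 'g word \<Rightarrow> bool" where
  "word_equiv S R = (sup (word_step S R) (word_step S R)\<inverse>\<inverse>)\<^sup>*\<^sup>*"

text \<open>G is presented by generators S (mapped by f) and relations R: the generators generate
  G, and a word over S represents the identity in G iff it is trivial in the presented group
  (so G is isomorphic to the free group on S modulo the normal closure of the relations).\<close>
definition is_presentation ::
  "('a, 'b) monoid_scheme \<Rightarrow> 'g set \<Rightarrow> ('g \<Rightarrow> 'a) \<Rightarrow> ('g word \<times> 'g word) set \<Rightarrow> bool" where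
  "is_presentation G S f R \<longleftrightarrow>
     group G \<and> f ` S \<subseteq> carrier G \<and> R \<subseteq> words S \<times> words S \<and>
     eval_word G f ` words S = carrier G \<and>
     (\<forall>w \<in> words S. eval_word G f w = \<one>\<^bsub>G\<^esub> \<longleftrightarrow> word_equiv S R w [])"

text \<open>Generators: a_i = Inl i (i < n), c_t = Inr t (t < m); indices are 0-based.\<close>
definition gens :: "nat \<Rightarrow> nat \<Rightarrow> (nat + nat) set" where
  "gens n m = Inl ` {..<n} \<union> Inr ` {..<m}"

definition comm_word :: "'g \<Rightarrow> 'g \<Rightarrow> 'g word" where
  "comm_word x y = [(x, False), (y, False), (x, True), (y, True)]"

definition pow_word :: "'g \<Rightarrow> int \<Rightarrow> 'g word" where
  "pow_word x k = replicate (nat \<bar>k\<bar>) (x, k \<ge> 0)"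

definition cprod_word :: "nat \<Rightarrow> (nat \<Rightarrow> nat \<Rightarrow> nat \<Rightarrow> int) \<Rightarrow> nat \<Rightarrow> nat \<Rightarrow> (nat + nat) word" where
  "cprod_word m lam i j = concat (map (\<lambda>t. pow_word (Inr t) (lam i j t)) [0..<m])"

definition rels :: "nat \<Rightarrow> nat \<Rightarrow> (nat \<Rightarrow> nat \<Rightarrow> nat \<Rightarrow> int) \<Rightarrow> ((nat + nat) word \<times> (nat + nat) word) set" where
  "rels n m lam =
     {(comm_word (Inl i) (Inl j), cprod_word m lam i j) | i j. i < j \<and> j < n}
   \<union> {(comm_word (Inl i) (Inr j), []) | i j. i < n \<and> j < m}
   \<union> {(comm_word (Inr k) (Inr r), []) | k r. k < m \<and> r < m}"

definition has_nilpotent_presentation :: "('a, 'b) monoid_scheme \<Rightarrow> nat \<Rightarrow> nat \<Rightarrow> bool" where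
  "has_nilpotent_presentation G n m \<longleftrightarrow>
     (\<exists>lam f. is_presentation G (gens n m) f (rels n m lam))"

end

theory Submission
  imports Defs
begin

text \<open>Both conditions are equivalent to the existence of elements \<open>a\<^sub>0, ..., a\<^sub>n\<^sub>-\<^sub>1\<close> and central
  elements \<open>c\<^sub>0, ..., c\<^sub>m\<^sub>-\<^sub>1\<close> of \<open>G\<close> such that every element is uniquely an ordered product of powers
  of the \<open>a\<^sub>i\<close> followed by powers of the \<open>c\<^sub>t\<close>, and the commutators of the \<open>a\<^sub>i\<close> lie in the span \<open>C\<close>
  of the \<open>c\<^sub>t\<close>. In a presented group such an ordered form exists by collecting, and it is unique
  because the relations hold in an explicit central extension of free abelian groups. Given such
  elements, the rank conditions follow by comparing the chains \<open>1 \<le> C \<le> Z(G)\<close> and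
  \<open>C \<le> Z(G) \<le> G\<close>. Conversely, let \<open>I\<close> be the isolator of \<open>G'\<close> in \<open>Z(G)\<close>, which has the rank of \<open>G'\<close>. As
  \<open>I\<close>, \<open>Z(G)/I\<close> and \<open>G/Z(G)\<close> are free abelian, stacking their bases gives an ordered basis of \<open>G\<close>
  with \<open>n + m\<close> elements; its last \<open>m\<close> elements are central and their span contains \<open>I\<close>.\<close>

section \<open>Ordered products of powers\<close>

text \<open>\<open>Z(G)/G'\<close> may have torsion, so a basis of \<open>G'\<close> need not extend
  to one of the center. The isolator \<open>I\<close> repairs this: \<open>Z(G)/I\<close> is
  torsion-free. The bound \<open>rank(G') \<le> m\<close> makes a basis of \<open>I\<close> fit
  among the last \<open>m\<close> basis elements, and \<open>m \<le> rank(Z(G))\<close> keeps these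
  \<open>m\<close> elements inside the center. When \<open>n\<close> exceeds
  \<open>rank(G/Z(G))\<close>, the surplus \<open>a\<close>'s are central elements.
  \<open>grp_rank\<close> is a \<open>LEAST\<close>, so it has its intended meaning only for
  finitely generated groups; finite generation of the center and of \<open>G'\<close> therefore has
  to be proved before their ranks can be used. All ranks are read off from bases, and bases are
  stacked along homomorphisms: a family for the image, lifted, followed by one for the kernel. This
  works in the nonabelian \<open>G\<close> too, because ordered products fix the order of the
  factors. Uniqueness of ordered forms enters only as \<open>indep\<close>, which speaks of trivial
  products. This suffices for presentations, which are likewise determined by the words that are
  trivial in \<open>G\<close>.\<close>

primrec ordprod :: "('a, 'b) monoid_scheme \<Rightarrow> (nat \<Rightarrow> 'a) \<Rightarrow> (nat \<Rightarrow> int) \<Rightarrow> nat \<Rightarrow> 'a" where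
  "ordprod G b x 0 = \<one>\<^bsub>G\<^esub>"
| "ordprod G b x (Suc k) = ordprod G b x k \<otimes>\<^bsub>G\<^esub> b k [^]\<^bsub>G\<^esub> x k"

text \<open>Each element has to be a single ordered product, which in a nonabelian group demands
  more than generation. Exponents are total functions of which only the values below
  \<open>k\<close> matter.\<close>

definition spans :: "('a, 'b) monoid_scheme \<Rightarrow> 'a set \<Rightarrow> nat \<Rightarrow> (nat \<Rightarrow> 'a) \<Rightarrow> bool" where
  "spans G D k b \<longleftrightarrow> (\<forall>i<k. b i \<in> D) \<and> (\<forall>g\<in>D. \<exists>x. g = ordprod G b x k)"

definition indep :: "('a, 'b) monoid_scheme \<Rightarrow> nat \<Rightarrow> (nat \<Rightarrow> 'a) \<Rightarrow> bool" where
  "indep G k b \<longleftrightarrow> (\<forall>x. ordprod G b x k = \<one>\<^bsub>G\<^esub> \<longrightarrow> (\<forall>i<k. x i = 0))"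

definition append_fun :: "nat \<Rightarrow> (nat \<Rightarrow> 'a) \<Rightarrow> (nat \<Rightarrow> 'a) \<Rightarrow> nat \<Rightarrow> 'a" where
  "append_fun k b c i = (if i < k then b i else c (i - k))"

lemma append_fun_simps [simp]:
  "i < k \<Longrightarrow> append_fun k b c i = b i"
  "append_fun k b c (i + k) = c i"
  "append_fun k b c (k + i) = c i"
  by (auto simp: append_fun_def)

lemma ordprod_cong:
  "(\<And>i. i < k \<Longrightarrow> b i = b' i) \<Longrightarrow> (\<And>i. i < k \<Longrightarrow> x i = x' i) \<Longrightarrow>
    ordprod G b x k = ordprod G b' x' k"
  by (induction k) auto

lemma spans_cong: "(\<And>i. i < k \<Longrightarrow> b i = b' i) \<Longrightarrow> spans G D k b = spans G D k b'"
  unfolding spans_def by (auto simp: ordprod_cong[of k b b'])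

lemma indep_cong: "(\<And>i. i < k \<Longrightarrow> b i = b' i) \<Longrightarrow> indep G k b = indep G k b'"
  unfolding indep_def by (simp add: ordprod_cong[of k b b'])

lemma spansI:
  assumes "\<forall>i<k. b i \<in> D" "\<And>g. g \<in> D \<Longrightarrow> \<exists>x. g = ordprod G b x k"
  shows "spans G D k b"
  using assms by (auto simp: spans_def)

lemma spansD:
  assumes "spans G D k b"
  shows "\<forall>i<k. b i \<in> D" and "g \<in> D \<Longrightarrow> \<exists>x. g = ordprod G b x k"
  using assms by (auto simp: spans_def)

context group
begin

lemma ordprod_subgroup:
  assumes "subgroup H G" "\<forall>i<k. b i \<in> H"
  shows "ordprod G b x k \<in> H"
  using assms(2)
proof (induction k)
  case 0
  then show ?case using assms(1) by (simp add: subgroup.one_closed)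
next
  case (Suc k)
  then show ?case
    using assms(1) subgroup_int_pow_closed[OF assms(1)] by (simp add: subgroup.m_closed)
qed

lemma ordprod_closed [simp, intro]:
  "(\<And>i. i < k \<Longrightarrow> b i \<in> carrier G) \<Longrightarrow> ordprod G b x k \<in> carrier G"
  using ordprod_subgroup[OF subgroup_self] by blast

lemma ordprod_zero: "(\<And>i. i < k \<Longrightarrow> x i = 0) \<Longrightarrow> ordprod G b x k = \<one>"
  by (induction k) auto

lemma ordprod_add_index:
  assumes "\<forall>i<k + l. b i \<in> carrier G"
  shows "ordprod G b x (k + l) =
    ordprod G b x k \<otimes> ordprod G (\<lambda>i. b (k + i)) (\<lambda>i. x (k + i)) l"
  using assms
  by (induction l) (simp_all add: m_assoc)

lemma ordprod_append:
  assumes "\<forall>i<k. b i \<in> carrier G" "\<forall>i<l. c i \<in> carrier G"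
  shows "ordprod G (append_fun k b c) (append_fun k x y) (k + l) =
    ordprod G b x k \<otimes> ordprod G c y l"
proof -
  have *: "append_fun k b c i \<in> carrier G" if "i < k + l" for i
    using that assms by (auto simp: append_fun_def)
  have 1: "ordprod G (append_fun k b c) (append_fun k x y) k = ordprod G b x k"
    by (rule ordprod_cong) auto
  show ?thesis
    using ordprod_add_index[of k l "append_fun k b c" "append_fun k x y"] *
    by (simp add: 1)
qed

lemma ordprod_append_split:
  assumes "\<forall>i<k. b i \<in> carrier G" "\<forall>i<l. c i \<in> carrier G"
  shows "ordprod G (append_fun k b c) x (k + l) =
    ordprod G b x k \<otimes> ordprod G c (\<lambda>i. x (k + i)) l"
proof -
  have "append_fun k x (\<lambda>i. x (k + i)) = x"
    by (auto simp: append_fun_def fun_eq_iff)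
  then show ?thesis using ordprod_append[of k b l c x "\<lambda>i. x (k + i)"] assms by simp
qed

lemma ordprod_unit:
  assumes "\<forall>i<k. b i \<in> carrier G" "j < k"
  shows "ordprod G b (\<lambda>i. if i = j then e else 0) k = b j [^] e"
  using assms
proof (induction k)
  case (Suc k)
  show ?case
  proof (cases "j = k")
    case True
    then have "ordprod G b (\<lambda>i. if i = j then e else 0) k = \<one>"
      by (intro ordprod_zero) auto
    then show ?thesis using True Suc.prems by simp
  next
    case False
    then show ?thesis using Suc by simp
  qed
qed simp

lemma ordprod_consistent:
  assumes "subgroup H G" "\<forall>i<k. b i \<in> H"
  shows "ordprod (G\<lparr>carrier := H\<rparr>) b x k = ordprod G b x k"
  using assms(2)
  by (induction k) (simp_all add: int_pow_consistent[OF assms(1)])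

lemma ordprod_hom:
  assumes "group H" "h \<in> hom G H" "\<forall>i<k. b i \<in> carrier G"
  shows "h (ordprod G b x k) = ordprod H (\<lambda>i. h (b i)) x k"
  using assms(3)
proof (induction k)
  case 0
  then show ?case using assms hom_one is_group by fastforce
next
  case (Suc k)
  then show ?case
    using assms(1,2) by (simp add: hom_mult[OF assms(2)] hom_int_pow[OF assms(2) _ is_group])
qed

section \<open>Stacking families along a homomorphism\<close>

lemma spans_chain:
  assumes H: "group H" and A: "subgroup A G"
    and h: "h \<in> hom (G\<lparr>carrier := A\<rparr>) H"
    and b: "\<forall>i<k. b i \<in> A" and hb: "spans H (h ` A) k (\<lambda>i. h (b i))"
    and c: "spans G {a \<in> A. h a = \<one>\<^bsub>H\<^esub>} l c"
  shows "spans G A (k + l) (append_fun k b c)"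
proof (rule spansI)
  interpret A: group "G\<lparr>carrier := A\<rparr>"
    using A subgroup.subgroup_is_group is_group by blast
  interpret h: group_hom "G\<lparr>carrier := A\<rparr>" H h
    using H h A.is_group by (simp add: group_hom_def group_hom_axioms_def)
  have bG: "\<forall>i<k. b i \<in> carrier G" and AG: "\<And>a. a \<in> A \<Longrightarrow> a \<in> carrier G"
    using A b subgroup.subset by blast+
  have cA: "\<forall>i<l. c i \<in> A" using spansD(1)[OF c] by blast
  then show "\<forall>i<k + l. append_fun k b c i \<in> A"
    using b by (auto simp: append_fun_def)
  fix g assume g: "g \<in> A"
  then obtain x where x: "h g = ordprod H (\<lambda>i. h (b i)) x k"
    using spansD(2)[OF hb] by blast
  define p where "p = ordprod G b x k"
  have pA: "p \<in> A" unfolding p_def by (rule ordprod_subgroup[OF A b])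
  have "h p = ordprod H (\<lambda>i. h (b i)) x k"
    using A.ordprod_hom[OF H h, of k b x] b ordprod_consistent[OF A b, where x = x]
    by (simp add: p_def)
  then have hp: "h g = h p" using x by simp
  have "h (inv p \<otimes> g) = \<one>\<^bsub>H\<^esub>"
    using h.hom_mult[of "inv p" g] h.hom_inv[of p] g pA hp A
    by (simp add: subgroup.m_inv_closed)
  moreover have "inv p \<otimes> g \<in> A" using g pA A by (simp add: subgroup_def)
  ultimately obtain y where y: "inv p \<otimes> g = ordprod G c y l"
    using spansD(2)[OF c] by blast
  have "g = p \<otimes> (inv p \<otimes> g)" using g pA AG by (simp add: m_assoc[symmetric])
  then have "g = ordprod G (append_fun k b c) (append_fun k x y) (k + l)"
    using ordprod_append[of k b l c x y] bG cA AG y p_def by metis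
  then show "\<exists>x. g = ordprod G (append_fun k b c) x (k + l)" by blast
qed

text \<open>Applying \<open>h\<close> to a trivial product erases the \<open>c\<close> part, so
  independence of the images kills the first \<open>k\<close> exponents. What remains is a trivial
  product of the \<open>c\<close>'s alone.\<close>

lemma indep_chain:
  assumes H: "group H" and A: "subgroup A G"
    and h: "h \<in> hom (G\<lparr>carrier := A\<rparr>) H"
    and b: "\<forall>i<k. b i \<in> A" and hb: "indep H k (\<lambda>i. h (b i))"
    and cA: "\<forall>i<l. c i \<in> A" and hc: "\<And>i. i < l \<Longrightarrow> h (c i) = \<one>\<^bsub>H\<^esub>"
    and c: "indep G l c"
  shows "indep G (k + l) (append_fun k b c)"
  unfolding indep_def
proof (intro allI impI)
  interpret A: group "G\<lparr>carrier := A\<rparr>"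
    using A subgroup.subgroup_is_group is_group by blast
  interpret H: group H by (rule H)
  interpret h: group_hom "G\<lparr>carrier := A\<rparr>" H h
    using H h A.is_group by (simp add: group_hom_def group_hom_axioms_def)
  have bG: "\<forall>i<k. b i \<in> carrier G" and cG: "\<forall>i<l. c i \<in> carrier G"
    using A b cA subgroup.subset by blast+
  fix x i assume "ordprod G (append_fun k b c) x (k + l) = \<one>" and i: "i < k + l"
  then have 1: "ordprod G b x k \<otimes> ordprod G c (\<lambda>i. x (k + i)) l = \<one>"
    using ordprod_append_split[OF bG cG] by simp
  have h1: "h (ordprod G b x k) = ordprod H (\<lambda>i. h (b i)) x k" for x
    using A.ordprod_hom[OF H h, of k b x] b ordprod_consistent[OF A b, where x = x] by simp
  have "ordprod H (\<lambda>i. \<one>\<^bsub>H\<^esub>) y j = \<one>\<^bsub>H\<^esub>" for y j by (induction j) auto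
  then have h2: "h (ordprod G c y l) = \<one>\<^bsub>H\<^esub>" for y
    using A.ordprod_hom[OF H h, of l c y] cA ordprod_consistent[OF A cA, where x = y] hc
      ordprod_cong[of l "\<lambda>i. h (c i)" "\<lambda>i. \<one>\<^bsub>H\<^esub>" y y H] by simp
  have in_A: "ordprod G b x k \<in> A" "ordprod G c (\<lambda>i. x (k + i)) l \<in> A"
    using ordprod_subgroup[OF A] b cA by auto
  have "\<one>\<^bsub>H\<^esub> = h (ordprod G b x k)"
    using h.hom_mult[of "ordprod G b x k" "ordprod G c (\<lambda>i. x (k + i)) l"] in_A 1 h2 h.hom_one
    by simp
  then have x0: "\<forall>i<k. x i = 0" using hb h1 unfolding indep_def by metis
  then have "ordprod G b x k = \<one>" using ordprod_zero by simp
  then have "ordprod G c (\<lambda>i. x (k + i)) l = \<one>" using 1 cG by simp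
  then have "\<forall>j<l. x (k + j) = 0" using c unfolding indep_def by blast
  then show "x i = 0" using x0 i
    by (metis add_diff_inverse_nat nat_add_left_cancel_less)
qed

end

section \<open>Bases and ranks of abelian groups\<close>

context comm_group
begin

lemma ordprod_add:
  assumes "\<forall>i<k. b i \<in> carrier G"
  shows "ordprod G b (\<lambda>i. x i + y i) k = ordprod G b x k \<otimes> ordprod G b y k"
  using assms
proof (induction k)
  case (Suc k)
  then have "ordprod G b x k \<in> carrier G" "ordprod G b y k \<in> carrier G" "b k \<in> carrier G"
    by auto
  then show ?case using Suc by (simp add: int_pow_mult m_ac)
qed simp

lemma ordprod_scale:
  assumes "\<forall>i<k. b i \<in> carrier G"
  shows "ordprod G b (\<lambda>i. x i * c) k = ordprod G b x k [^] (c::int)"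
  using assms
  by (induction k) (simp_all add: int_pow_pow int_pow_distrib)

lemma ordprod_minus:
  assumes "\<forall>i<k. b i \<in> carrier G"
  shows "ordprod G b (\<lambda>i. - x i) k = inv (ordprod G b x k)"
  using ordprod_scale[of k b x "-1", OF assms] assms by (simp add: int_pow_neg)

lemma ordprod_upd_exp:
  assumes "\<forall>i<k. b i \<in> carrier G" "j < k"
  shows "ordprod G b (x(j := x j + e)) k = ordprod G b x k \<otimes> b j [^] e"
proof -
  have "x(j := x j + e) = (\<lambda>i. x i + (if i = j then e else 0))" by auto
  then show ?thesis using ordprod_add[OF assms(1)] ordprod_unit[OF assms] by simp
qed

text \<open>This is an elementary operation: changing the family by a column operation amounts to
  the dual operation on the exponents. It drives the descent that produces bases.\<close>

lemma ordprod_upd_base: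
  assumes b: "\<forall>i<k. b i \<in> carrier G" and ij: "i < k" "j < k" "i \<noteq> j"
  shows "ordprod G (b(j := b j \<otimes> b i [^] s)) x k = ordprod G b (x(i := x i + s * x j)) k"
proof -
  let ?b = "b(j := b j \<otimes> b i [^] s)"
  have b': "\<forall>l<k. ?b l \<in> carrier G" using b ij by simp
  \<comment> \<open>With exponent 0 at \<open>j\<close> the product does not see the modified base
    element, so only the split-off power of \<open>?b j\<close> has to be expanded.\<close>
  have xj: "x = (x(j := 0))(j := (x(j := 0)) j + x j)" by auto
  have 0: "ordprod G ?b (x(j := 0)) k = ordprod G b (x(j := 0)) k"
  proof -
    have "ordprod G ?b (x(j := 0)) l = ordprod G b (x(j := 0)) l" for l
      by (induction l) auto
    then show ?thesis .
  qed
  have c: "ordprod G b (x(j := 0)) k \<in> carrier G" "b j \<in> carrier G" "b i \<in> carrier G"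
    using b ij by auto
  have "ordprod G ?b x k = ordprod G ?b (x(j := 0)) k \<otimes> ?b j [^] x j"
    using ordprod_upd_exp[OF b' ij(2), of "x(j := 0)" "x j"] unfolding xj[symmetric] .
  also have "\<dots> = (ordprod G b (x(j := 0)) k \<otimes> b j [^] x j) \<otimes> b i [^] (s * x j)"
    using c by (simp add: 0 int_pow_distrib int_pow_pow m_assoc)
  also have "ordprod G b (x(j := 0)) k \<otimes> b j [^] x j = ordprod G b x k"
    using ordprod_upd_exp[OF b ij(2), of "x(j := 0)" "x j"] by simp
  also have "ordprod G b x k \<otimes> b i [^] (s * x j) = ordprod G b (x(i := x i + s * x j)) k"
    using ordprod_upd_exp[OF b ij(1)] by simp
  finally show ?thesis .
qed

lemma subgroup_ordprods:
  assumes "\<forall>i<k. b i \<in> carrier G"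
  shows "subgroup (range (\<lambda>x. ordprod G b x k)) G"
proof (rule subgroupI)
  show "range (\<lambda>x. ordprod G b x k) \<subseteq> carrier G" using assms by auto
  show "range (\<lambda>x. ordprod G b x k) \<noteq> {}" by auto
next
  fix a assume "a \<in> range (\<lambda>x. ordprod G b x k)"
  then obtain x where "a = ordprod G b x k" by auto
  then have "inv a = ordprod G b (\<lambda>i. - x i) k" using ordprod_minus[OF assms] by simp
  then show "inv a \<in> range (\<lambda>x. ordprod G b x k)" by blast
next
  fix a c assume "a \<in> range (\<lambda>x. ordprod G b x k)" "c \<in> range (\<lambda>x. ordprod G b x k)"
  then obtain x y where "a = ordprod G b x k" "c = ordprod G b y k" by auto
  then have "a \<otimes> c = ordprod G b (\<lambda>i. x i + y i) k" using ordprod_add[OF assms] by simp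
  then show "a \<otimes> c \<in> range (\<lambda>x. ordprod G b x k)" by blast
qed

lemma ordprods_eq_generate:
  assumes "\<forall>i<k. b i \<in> carrier G"
  shows "range (\<lambda>x. ordprod G b x k) = generate G (b ` {..<k})"
proof (rule generateI)
  show "subgroup (range (\<lambda>x. ordprod G b x k)) G" by (rule subgroup_ordprods[OF assms])
  show "b ` {..<k} \<subseteq> range (\<lambda>x. ordprod G b x k)"
  proof
    fix g assume "g \<in> b ` {..<k}"
    then obtain j where "j < k" "g = b j" by auto
    then have "g = ordprod G b (\<lambda>i. if i = j then 1 else 0) k"
      using ordprod_unit[of k b j 1] assms by simp
    then show "g \<in> range (\<lambda>x. ordprod G b x k)" by blast
  qed
  fix K assume "subgroup K G" "b ` {..<k} \<subseteq> K"
  then show "range (\<lambda>x. ordprod G b x k) \<subseteq> K" using ordprod_subgroup[of K k b] by blast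
qed

lemma spans_iff_generate:
  assumes "subgroup D G"
  shows "spans G D k b \<longleftrightarrow> b ` {..<k} \<subseteq> D \<and> generate G (b ` {..<k}) = D"
proof
  assume s: "spans G D k b"
  then have bD: "\<forall>i<k. b i \<in> D" by (auto simp: spans_def)
  have "D \<subseteq> range (\<lambda>x. ordprod G b x k)" using s by (auto simp: spans_def)
  moreover have "range (\<lambda>x. ordprod G b x k) \<subseteq> D" using ordprod_subgroup[OF assms bD] by auto
  ultimately show "b ` {..<k} \<subseteq> D \<and> generate G (b ` {..<k}) = D"
    using ordprods_eq_generate[of k b] bD subgroup.subset[OF assms] by auto
next
  assume r: "b ` {..<k} \<subseteq> D \<and> generate G (b ` {..<k}) = D"
  then have "\<forall>i<k. b i \<in> carrier G" using subgroup.subset[OF assms] by auto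
  from ordprods_eq_generate[of k b, OF this] r show "spans G D k b"
    unfolding spans_def by blast
qed

section \<open>Existence of bases\<close>

lemma spans_pad:
  assumes D: "subgroup D G" and S: "finite S" "S \<subseteq> D" "generate G S = D" and c: "card S \<le> k"
  shows "\<exists>b. spans G D k b"
proof -
  obtain e where e: "bij_betw e {..<card S} S"
    using ex_bij_betw_nat_finite[OF S(1)] atLeast0LessThan by auto
  define b where "b i = (if i < card S then e i else \<one>)" for i
  have "b ` {..<card S} = S" using e by (auto simp: b_def bij_betw_def)
  then have sub: "S \<subseteq> b ` {..<k}" using c by force
  have bD: "b ` {..<k} \<subseteq> D"
    using S(2) e subgroup.one_closed[OF D] by (auto simp: b_def bij_betw_def)
  have "generate G (b ` {..<k}) = D"
    using mono_generate[OF sub] generate_subgroup_incl[OF bD D] S(3) by auto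
  then show ?thesis using bD spans_iff_generate[OF D] by blast
qed

text \<open>A Euclidean algorithm on the coefficients of the relation \<open>x\<close>. While two
  are nonzero, a change of the family lowers the sum of their absolute values. Once a single one is
  left, torsion-freeness makes its base element trivial, and that element is dropped.\<close>

lemma spans_dependent_step:
  assumes D: "subgroup D G"
    and tf: "\<forall>g\<in>D. \<forall>n::int. n \<noteq> 0 \<longrightarrow> g [^] n = \<one> \<longrightarrow> g = \<one>"
    and "spans G D (Suc k) b" "ordprod G b x (Suc k) = \<one>" "\<exists>i<Suc k. x i \<noteq> 0"
  shows "\<exists>b. spans G D k b"
  using assms(3-5)
proof (induction "\<Sum>i<Suc k. nat \<bar>x i\<bar>" arbitrary: b x rule: less_induct)
  case less
  let ?k = "Suc k"
  have DG: "\<And>g. g \<in> D \<Longrightarrow> g \<in> carrier G" using subgroup.subset[OF D] by auto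
  have bD: "\<forall>i<?k. b i \<in> D" using spansD(1)[OF less.prems(1)] .
  then have bG: "\<forall>i<?k. b i \<in> carrier G" using DG by blast
  obtain i where i: "i < ?k" "x i \<noteq> 0" using less.prems(3) by blast
  show ?case
  proof (cases "\<exists>j<?k. j \<noteq> i \<and> x j \<noteq> 0")
    case False
    then have "ordprod G b x ?k = ordprod G b (\<lambda>l. if l = i then x i else 0) ?k"
      by (intro ordprod_cong) auto
    then have "b i [^] x i = \<one>" using ordprod_unit[OF bG i(1)] less.prems(2) by simp
    then have bi: "b i = \<one>" using tf bD i by blast
    let ?S = "b ` ({..<?k} - {i})"
    have SD: "?S \<subseteq> D" using bD by auto
    have "b ` {..<?k} \<subseteq> generate G ?S"
      using bi generate.one[of G ?S] generate.incl[of _ ?S G]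
      by (metis (no_types, lifting) DiffI image_eqI image_subsetI singletonD)
    then have "generate G (b ` {..<?k}) \<subseteq> generate G ?S"
      using generate_subgroup_incl[OF _ generate_is_subgroup] SD DG by (meson subset_iff)
    moreover have "generate G (b ` {..<?k}) = D"
      using spans_iff_generate[OF D] less.prems(1) by blast
    ultimately have "generate G ?S = D" using generate_subgroup_incl[OF SD D] by blast
    moreover have "card ?S \<le> k"
      using card_image_le[of "{..<?k} - {i}" b] i(1) by simp
    ultimately show ?thesis using spans_pad[OF D _ SD] by blast
  next
    case True
    then obtain j0 where j0: "j0 < ?k" "j0 \<noteq> i" "x j0 \<noteq> 0" by blast
    obtain p q where pq: "p < ?k" "q < ?k" "p \<noteq> q" "x p \<noteq> 0" "x q \<noteq> 0" "\<bar>x q\<bar> \<le> \<bar>x p\<bar>"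
      using i j0 by (metis linorder_le_cases)
    \<comment> \<open>This sign gives \<open>s * x q\<close> the sign of \<open>x p\<close> and the
      absolute value of \<open>x q\<close>, so subtracting it strictly shrinks \<open>x p\<close>.
      The relation stays nontrivial because \<open>x q\<close> is untouched.\<close>
    define s where "s = sgn (x p) * sgn (x q)"
    define x' where "x' = x(p := x p - s * x q)"
    define b' where "b' = b(q := b q \<otimes> b p [^] s)"
    have key: "ordprod G b' y ?k = ordprod G b (y(p := y p + s * y q)) ?k" for y
      unfolding b'_def by (rule ordprod_upd_base[OF bG pq(1-3)])
    have "ordprod G b' x' ?k = ordprod G b x ?k"
      unfolding key using pq(3) by (simp add: x'_def del: ordprod.simps)
    then have 1: "ordprod G b' x' ?k = \<one>" using less.prems(2) by simp
    have 2: "\<exists>i<?k. x' i \<noteq> 0" using pq by (auto simp: x'_def intro!: exI[of _ q])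
    have 3: "spans G D ?k b'"
    proof (rule spansI)
      show "\<forall>i<?k. b' i \<in> D"
        using bD pq D subgroup_int_pow_closed[OF D] by (auto simp: b'_def subgroup.m_closed)
      fix g assume "g \<in> D"
      then obtain y where y: "g = ordprod G b y ?k" using spansD(2)[OF less.prems(1)] by blast
      have "g = ordprod G b' (y(p := y p - s * y q)) ?k"
        unfolding key using pq(3) y by (simp del: ordprod.simps)
      then show "\<exists>x. g = ordprod G b' x ?k" by blast
    qed
    have "\<bar>x p - s * x q\<bar> < \<bar>x p\<bar>"
      using pq(4-6) by (auto simp: s_def sgn_if split: if_splits)
    then have lt: "nat \<bar>x' p\<bar> < nat \<bar>x p\<bar>" by (simp add: x'_def)
    have "(\<Sum>i<?k. nat \<bar>x' i\<bar>) < (\<Sum>i<?k. nat \<bar>x i\<bar>)"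
      by (rule sum_strict_mono_ex1) (use lt pq(1) in \<open>auto simp: x'_def\<close>)
    from less.hyps[OF this 3 1 2] show ?thesis .
  qed
qed

text \<open>A spanning family of least length is independent, since a nontrivial relation would
  allow a shorter one.\<close>

lemma exists_basis:
  assumes D: "subgroup D G"
    and tf: "\<forall>g\<in>D. \<forall>n::int. n \<noteq> 0 \<longrightarrow> g [^] n = \<one> \<longrightarrow> g = \<one>"
    and s: "spans G D k b"
  shows "\<exists>l\<le>k. \<exists>c. spans G D l c \<and> indep G l c"
proof -
  define l where "l = (LEAST l. \<exists>c. spans G D l c)"
  have ex: "\<exists>l c. spans G D l c" using s by blast
  have "\<exists>c. spans G D l c" using LeastI_ex[OF ex] by (simp only: l_def)
  then obtain c where c: "spans G D l c" by blast
  have lk: "l \<le> k" unfolding l_def by (rule Least_le) (use s in blast)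
  have "indep G l c"
  proof (rule ccontr)
    assume "\<not> indep G l c"
    then obtain x where x: "ordprod G c x l = \<one>" "\<exists>i<l. x i \<noteq> 0" by (auto simp: indep_def)
    then obtain l' where l': "l = Suc l'" by (cases l) auto
    have "\<exists>b. spans G D l' b"
      using spans_dependent_step[OF D tf] c x unfolding l' by blast
    then have "l \<le> l'" unfolding l_def by (rule Least_le)
    then show False using l' by simp
  qed
  then show ?thesis using c lk by blast
qed

text \<open>Counting modulo 2: the \<open>2 ^ k\<close> subset products of a basis are pairwise distinct modulo
  squares, and a product of \<open>l\<close> elements is determined modulo squares by the parities of its
  exponents.\<close>

lemma basis_le_spans:
  assumes ind: "indep G k b" and sb: "spans G D k b"
    and s: "spans G D l s" and D: "subgroup D G"
  shows "k \<le> l"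
proof -
  have DG: "\<And>g. g \<in> D \<Longrightarrow> g \<in> carrier G" using subgroup.subset[OF D] by auto
  note b = spansD(1)[OF sb]
  have bG: "\<forall>i<k. b i \<in> carrier G" and sG: "\<forall>i<l. s i \<in> carrier G"
    using b DG spansD(1)[OF s] by blast+
  define g where "g T = ordprod G b (\<lambda>i. of_bool (i \<in> T)) k" for T
  have gD: "g T \<in> D" for T unfolding g_def by (rule ordprod_subgroup[OF D b])
  have "\<forall>T. \<exists>e. g T = ordprod G s e l" using spansD(2)[OF s] gD by blast
  then obtain e where e: "\<And>T. g T = ordprod G s (e T) l" by metis
  define F where "F T = {j. j < l \<and> odd (e T j)}" for T
  have "inj_on F (Pow {..<k})"
  proof (rule inj_onI)
    fix T T' assume T: "T \<in> Pow {..<k}" "T' \<in> Pow {..<k}" and eq: "F T = F T'"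
    define f where "f j = (e T j - e T' j) div 2" for j
    have f: "e T j = e T' j + f j * 2" if "j < l" for j
    proof -
      have "odd (e T j) \<longleftrightarrow> odd (e T' j)" using eq that by (auto simp: F_def)
      then have "even (e T j - e T' j)" by simp
      then show ?thesis by (simp add: f_def)
    qed
    \<comment> \<open>\<open>h\<close> satisfies \<open>g T = g T' \<otimes> h [^] 2\<close>.
      Written in the basis, this becomes an identity of exponents whose parities force
      \<open>T = T'\<close>.\<close>
    define h where "h = ordprod G s f l"
    have "h \<in> D" unfolding h_def by (rule ordprod_subgroup[OF D spansD(1)[OF s]])
    then obtain y where y: "h = ordprod G b y k" using spansD(2)[OF sb] by blast
    have "g T = ordprod G s (\<lambda>j. e T' j + f j * 2) l"
      unfolding e by (rule ordprod_cong) (auto simp: f)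
    also have "\<dots> = g T' \<otimes> h [^] (2::int)"
      using sG by (simp add: ordprod_add[of l s "e T'" "\<lambda>j. f j * 2"] ordprod_scale e h_def)
    also have "\<dots> = ordprod G b (\<lambda>i. of_bool (i \<in> T') + y i * 2) k"
      using bG by (simp add: ordprod_add[of k b _ "\<lambda>j. y j * 2"] ordprod_scale g_def y)
    finally have "ordprod G b (\<lambda>i. of_bool (i \<in> T)) k =
        ordprod G b (\<lambda>i. of_bool (i \<in> T') + y i * 2) k"
      unfolding g_def .
    moreover have "ordprod G b (\<lambda>i. of_bool (i \<in> T) + - (of_bool (i \<in> T') + y i * 2)) k =
      ordprod G b (\<lambda>i. of_bool (i \<in> T)) k \<otimes> inv ordprod G b (\<lambda>i. of_bool (i \<in> T') + y i * 2) k"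
      using ordprod_add[OF bG, of "\<lambda>i. of_bool (i \<in> T)" "\<lambda>i. - (of_bool (i \<in> T') + y i * 2)"]
        ordprod_minus[OF bG, of "\<lambda>i. of_bool (i \<in> T') + y i * 2"] by argo
    ultimately have "ordprod G b (\<lambda>i. of_bool (i \<in> T) + - (of_bool (i \<in> T') + y i * 2)) k = \<one>"
      using bG by (simp add: r_inv)
    then have *: "of_bool (i \<in> T) + - (of_bool (i \<in> T') + y i * 2) = 0" if "i < k" for i
      using ind that unfolding indep_def by blast
    have "i \<in> T \<longleftrightarrow> i \<in> T'" if "i < k" for i
      using *[OF that] by (auto simp: of_bool_def split: if_splits) presburger+
    then show "T = T'" using T by auto
  qed
  moreover have "F ` Pow {..<k} \<subseteq> Pow {..<l}" by (auto simp: F_def)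
  ultimately have "card (Pow {..<k}) \<le> card (Pow {..<l})"
    by (rule card_inj_on_le) simp
  then show ?thesis by (simp add: card_Pow)
qed

lemma basis_card_unique:
  assumes "subgroup D G" "spans G D k b" "indep G k b" "spans G D l c" "indep G l c"
  shows "k = l"
  using basis_le_spans[of k b D l c] basis_le_spans[of l c D k b] assms by (metis le_antisym)

text \<open>Let \<open>D'\<close> be the span of the first \<open>k\<close> elements. By induction
  \<open>E \<inter> D'\<close> is spanned by \<open>k\<close> elements. The exponents of
  \<open>b k\<close> that occur in \<open>E\<close> modulo \<open>D'\<close> form a subgroup of the
  integers, so one further element of \<open>E\<close>, carrying a generator of that subgroup,
  completes the family.\<close>

lemma spans_subgroup:
  assumes "subgroup D G" "spans G D k b" "subgroup E G" "E \<subseteq> D"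
  shows "\<exists>c. spans G E k c"
  using assms
proof (induction k arbitrary: D E)
  case 0
  then show ?case by (auto simp: spans_def)
next
  case (Suc k)
  have bG: "\<forall>i<Suc k. b i \<in> carrier G"
    using spansD(1)[OF Suc.prems(2)] subgroup.subset[OF Suc.prems(1)] by blast
  define D' where "D' = range (\<lambda>x. ordprod G b x k)"
  have D': "subgroup D' G" unfolding D'_def using bG by (intro subgroup_ordprods) auto
  have sD': "spans G D' k b"
    using spans_iff_generate[OF D', of k b] ordprods_eq_generate[of k b] bG generate.incl[of _ "b ` {..<k}" G]
    by (auto simp: D'_def)
  have ED': "subgroup (E \<inter> D') G" using Suc.prems(3) D' by (rule subgroups_Inter_pair)
  obtain c where c: "spans G (E \<inter> D') k c"
    using Suc.IH[OF D' sD' ED'] by blast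
  have D'G: "\<And>a. a \<in> D' \<Longrightarrow> a \<in> carrier G" using subgroup.subset[OF D'] by blast
  have bk: "b k \<in> carrier G" using bG by simp
  have EG: "\<And>a. a \<in> E \<Longrightarrow> a \<in> carrier G" using subgroup.subset[OF Suc.prems(3)] by blast
  have dec: "\<exists>a\<in>D'. \<exists>e. g = a \<otimes> b k [^] (e::int)" if "g \<in> E" for g
    using spansD(2)[OF Suc.prems(2), of g] that Suc.prems(4) by (auto simp: D'_def)
  \<comment> \<open>If no positive exponent of \<open>b k\<close> occurs, inverses exclude negative
    ones too, so \<open>E\<close> lies in \<open>D'\<close> and \<open>h = \<one>\<close> works.
    Otherwise \<open>h\<close> realizes the least positive exponent \<open>d\<close>, and division
    with remainder leaves exponent 0.\<close>
  have "\<exists>h\<in>E. \<forall>g\<in>E. \<exists>y::int. g \<otimes> inv (h [^] y) \<in> E \<inter> D'"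
  proof (cases "\<exists>a\<in>D'. \<exists>e>0. a \<otimes> b k [^] (int e) \<in> E")
    case False
    have "g \<in> D'" if g: "g \<in> E" for g
    proof -
      obtain a e where ae: "a \<in> D'" "g = a \<otimes> b k [^] (e::int)" using dec[OF g] by blast
      have "\<not> e > 0" using False ae g by (metis zero_less_imp_eq_int)
      moreover have "\<not> e < 0"
      proof
        assume "e < 0"
        have "inv g = inv a \<otimes> b k [^] (- e)"
          using ae D'G bk by (simp add: inv_mult int_pow_neg)
        moreover have "inv g \<in> E" "inv a \<in> D'"
          using g ae Suc.prems(3) D' by (auto simp: subgroup.m_inv_closed)
        moreover obtain e' where "- e = int e'" "e' > 0"
          using \<open>e < 0\<close> by (metis neg_0_less_iff_less zero_less_imp_eq_int)
        ultimately show False using False by metis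
      qed
      ultimately have "e = 0" by simp
      then show ?thesis using ae D'G by simp
    qed
    then show ?thesis
      by (intro bexI[of _ \<one>]) (use Suc.prems(3) EG in \<open>auto simp: subgroup.one_closed\<close>)
  next
    case True
    define d where "d = (LEAST e. e > 0 \<and> (\<exists>a\<in>D'. a \<otimes> b k [^] (int e) \<in> E))"
    have ex: "\<exists>e. e > 0 \<and> (\<exists>a\<in>D'. a \<otimes> b k [^] (int e) \<in> E)" using True by blast
    have d: "d > 0 \<and> (\<exists>a\<in>D'. a \<otimes> b k [^] (int d) \<in> E)"
      using LeastI_ex[OF ex] by (simp only: d_def)
    have dmin: "e \<ge> d" if "e > 0" "a \<in> D'" "a \<otimes> b k [^] (int e) \<in> E" for e a
      unfolding d_def by (rule Least_le) (use that in blast)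
    obtain a0 where a0: "a0 \<in> D'" "a0 \<otimes> b k [^] (int d) \<in> E" using d by blast
    define h where "h = a0 \<otimes> b k [^] (int d)"
    show ?thesis
    proof (intro bexI[of _ h] ballI)
      show hE: "h \<in> E" using a0 by (simp add: h_def)
      fix g assume g: "g \<in> E"
      obtain a e where ae: "a \<in> D'" "g = a \<otimes> b k [^] (e::int)" using dec[OF g] by blast
      define y where "y = e div int d"
      define a1 where "a1 = a \<otimes> inv (a0 [^] y)"
      have a1: "a1 \<in> D'" unfolding a1_def using ae a0 D'
        by (simp add: subgroup.m_closed subgroup.m_inv_closed subgroup_int_pow_closed)
      have r: "g \<otimes> inv (h [^] y) = a1 \<otimes> b k [^] (e mod int d)"
      proof -
        have "h [^] y = a0 [^] y \<otimes> b k [^] (int d * y)"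
          using D'G[OF a0(1)] bk by (simp add: h_def int_pow_distrib int_pow_pow)
        then have "g \<otimes> inv (h [^] y) = a \<otimes> b k [^] e \<otimes> (inv (a0 [^] y) \<otimes> inv (b k [^] (int d * y)))"
          using ae D'G[OF a0(1)] bk by (simp add: inv_mult)
        also have "\<dots> = a1 \<otimes> (b k [^] e \<otimes> inv (b k [^] (int d * y)))"
          using D'G[OF a0(1)] D'G[OF ae(1)] bk by (simp add: a1_def m_ac)
        also have "b k [^] e \<otimes> inv (b k [^] (int d * y)) = b k [^] (e mod int d)"
          using bk int_pow_diff[of "b k" e "int d * y"]
          by (simp add: y_def minus_mult_div_eq_mod)
        finally show ?thesis .
      qed
      have E: "g \<otimes> inv (h [^] y) \<in> E" using g hE Suc.prems(3)
        by (simp add: subgroup.m_closed subgroup.m_inv_closed subgroup_int_pow_closed)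
      have "e mod int d = 0"
      proof (rule ccontr)
        assume n: "e mod int d \<noteq> 0"
        have "e mod int d \<ge> 0" "e mod int d < int d" using d by simp_all
        then obtain f where "e mod int d = int f" "f > 0" "f < d"
          using n by (metis nat_int_comparison(2) not_gr_zero of_nat_0 zero_le_imp_eq_int)
        then show False using dmin[of f a1] a1 E r by simp
      qed
      then have "g \<otimes> inv (h [^] y) = a1" using r a1 D'G by simp
      then show "\<exists>y::int. g \<otimes> inv (h [^] y) \<in> E \<inter> D'" using E a1 by (metis IntI)
    qed
  qed
  then obtain h where h: "h \<in> E" "\<And>g. g \<in> E \<Longrightarrow> \<exists>y::int. g \<otimes> inv (h [^] y) \<in> E \<inter> D'" by blast
  have "spans G E (Suc k) (c(k := h))"
  proof (rule spansI)
    show "\<forall>i<Suc k. (c(k := h)) i \<in> E"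
      using h(1) spansD(1)[OF c] by (auto simp: less_Suc_eq)
    fix g assume g: "g \<in> E"
    then obtain y :: int where y: "g \<otimes> inv (h [^] y) \<in> E \<inter> D'" using h by blast
    then obtain x where x: "g \<otimes> inv (h [^] y) = ordprod G c x k" using spansD(2)[OF c] by blast
    have "g = g \<otimes> inv (h [^] y) \<otimes> h [^] y" using EG[OF g] EG[OF h(1)] by (simp add: m_assoc)
    also have "\<dots> = ordprod G (c(k := h)) (x(k := y)) (Suc k)"
      using x ordprod_cong[of k c "c(k := h)" x "x(k := y)" G] by simp
    finally show "\<exists>x. g = ordprod G (c(k := h)) x (Suc k)" by blast
  qed
  then show ?case by blast
qed

end

section \<open>Ranks measured by bases\<close>

lemma (in group) ordprod_base_pow:
  assumes "\<forall>i<k. b i \<in> carrier G"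
  shows "ordprod G (\<lambda>i. b i [^] (e i::int)) x k = ordprod G b (\<lambda>i. e i * x i) k"
  using assms by (induction k) (simp_all add: int_pow_pow)

lemma (in comm_group) subgroup_is_comm_group:
  assumes "subgroup H G"
  shows "comm_group (G\<lparr>carrier := H\<rparr>)"
proof (rule group.group_comm_groupI)
  show "group (G\<lparr>carrier := H\<rparr>)" using subgroup.subgroup_is_group[OF assms is_group] .
qed (use m_comm subgroup.subset[OF assms] in auto)

lemma (in group) spans_ordprods:
  assumes b: "\<forall>i<k. b i \<in> carrier G"
  shows "spans G (range (\<lambda>x. ordprod G b x k)) k b"
proof (rule spansI)
  show "\<forall>i<k. b i \<in> range (\<lambda>x. ordprod G b x k)"
  proof (intro allI impI)
    fix i assume i: "i < k"
    then have "b i = ordprod G b (\<lambda>j. if j = i then 1 else 0) k"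
      using ordprod_unit[OF b i, of 1] b by simp
    then show "b i \<in> range (\<lambda>x. ordprod G b x k)" by blast
  qed
qed auto

text \<open>The family \<open>b\<close> need not span \<open>D\<close>, but it is a basis of its own
  span, which as a subgroup of \<open>D\<close> is spanned by \<open>l\<close> elements as
  well.\<close>

lemma (in comm_group) indep_le_spans:
  assumes b: "\<forall>i<k. b i \<in> D" and ind: "indep G k b" and s: "spans G D l s" and D: "subgroup D G"
  shows "k \<le> l"
proof -
  let ?R = "range (\<lambda>x. ordprod G b x k)"
  have bG: "\<forall>i<k. b i \<in> carrier G" using b subgroup.subset[OF D] by blast
  note R = subgroup_ordprods[OF bG]
  have "?R \<subseteq> D" using ordprod_subgroup[OF D b] by blast
  then obtain c where "spans G ?R l c" using spans_subgroup[OF D s R] by blast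
  with basis_le_spans[OF ind spans_ordprods[OF bG] _ R]
  show ?thesis by blast
qed

lemma (in comm_group) basis_torsion_free:
  assumes D: "subgroup D G" and s: "spans G D k b" and i: "indep G k b"
  shows "\<forall>g\<in>D. \<forall>n::int. n \<noteq> 0 \<longrightarrow> g [^] n = \<one> \<longrightarrow> g = \<one>"
proof (intro ballI allI impI)
  fix g and n :: int assume g: "g \<in> D" and n: "n \<noteq> 0" "g [^] n = \<one>"
  have bG: "\<forall>i<k. b i \<in> carrier G" using spansD(1)[OF s] subgroup.subset[OF D] by blast
  obtain x where x: "g = ordprod G b x k" using spansD(2)[OF s g] by blast
  have "ordprod G b (\<lambda>i. x i * n) k = \<one>" using ordprod_scale[OF bG] n(2) x by simp
  then have "\<forall>i<k. x i * n = 0" using i unfolding indep_def by blast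
  then have "\<forall>i<k. x i = 0" using n(1) by simp
  then show "g = \<one>" using x ordprod_zero by simp
qed

lemma (in comm_group) grp_rank_le:
  assumes "spans G (carrier G) k b"
  shows "grp_rank G \<le> k"
proof -
  have "b ` {..<k} \<subseteq> carrier G" "generate G (b ` {..<k}) = carrier G"
    using spans_iff_generate[OF subgroup_self] assms by blast+
  then have "grp_rank G \<le> card (b ` {..<k})"
    unfolding grp_rank_def by (intro Least_le exI[of _ "b ` {..<k}"]) simp
  then show ?thesis using card_image_le[of "{..<k}" b] by simp
qed

text \<open>Finite generation guarantees that the minimum defining \<open>grp_rank\<close> is
  attained.\<close>

lemma (in comm_group) spans_grp_rank:
  assumes "fin_gen G"
  shows "\<exists>b. spans G (carrier G) (grp_rank G) b"
proof -
  have ex: "\<exists>k S. finite S \<and> S \<subseteq> carrier G \<and> card S = k \<and> generate G S = carrier G"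
    using assms by (auto simp: fin_gen_def)
  obtain S where "finite S" "S \<subseteq> carrier G" "card S = grp_rank G" "generate G S = carrier G"
    using LeastI_ex[OF ex] by (auto simp: grp_rank_def)
  then show ?thesis using spans_pad[OF subgroup_self] by simp
qed

lemma (in comm_group) spans_imp_fin_gen:
  assumes "spans G (carrier G) k b"
  shows "fin_gen G"
proof -
  have "finite (b ` {..<k})" by simp
  then show ?thesis
    using spans_iff_generate[OF subgroup_self, of k b] assms unfolding fin_gen_def by blast
qed

text \<open>The basis itself bounds the rank from above; a generating set of minimal size spans, so
  it cannot be shorter than a basis.\<close>

lemma (in comm_group) grp_rank_eq:
  assumes "spans G (carrier G) k b" "indep G k b"
  shows "grp_rank G = k"
proof -
  obtain c where "spans G (carrier G) (grp_rank G) c"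
    using spans_grp_rank[OF spans_imp_fin_gen[OF assms(1)]] by blast
  then have "k \<le> grp_rank G"
    using basis_le_spans[of k b "carrier G"] assms subgroup_self by blast
  then show ?thesis using grp_rank_le[OF assms(1)] by simp
qed

text \<open>Central subgroups are treated inside the abelian group carried by the center, where the
  results on \<open>comm_group\<close> apply; this moves spanning statements there and back.\<close>

lemma (in group) spans_consistent:
  assumes "subgroup H G" "D \<subseteq> H"
  shows "spans (G\<lparr>carrier := H\<rparr>) D k b \<longleftrightarrow> spans G D k b"
proof (cases "\<forall>i<k. b i \<in> D")
  case True
  then have "\<forall>i<k. b i \<in> H" using assms by blast
  then show ?thesis by (simp add: spans_def ordprod_consistent[OF assms(1)])
qed (auto simp: spans_def)

lemma (in group) indep_consistent:
  assumes "subgroup H G" "\<forall>i<k. b i \<in> H"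
  shows "indep (G\<lparr>carrier := H\<rparr>) k b \<longleftrightarrow> indep G k b"
  by (simp add: indep_def ordprod_consistent[OF assms])

section \<open>Centers, quotients and collection\<close>

context group
begin

lemma torsion_freeD:
  assumes "torsion_free G"
  shows "\<forall>g\<in>carrier G. \<forall>n::int. n \<noteq> 0 \<longrightarrow> g [^] n = \<one> \<longrightarrow> g = \<one>"
proof (intro ballI allI impI)
  fix g and n :: int assume g: "g \<in> carrier G" and n: "n \<noteq> 0" "g [^] n = \<one>"
  obtain k where k: "n = int k \<or> n = - int k" by (metis int_cases2)
  then have "g [^] k = \<one>"
    using n(2) g by (auto simp: int_pow_int int_pow_neg_int inv_eq_1_iff)
  moreover have "k > 0" using k n(1) by auto
  ultimately show "g = \<one>" using assms g unfolding torsion_free_def by blast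
qed

lemma torsion_freeI:
  assumes "\<forall>g\<in>carrier G. \<forall>n::int. n \<noteq> 0 \<longrightarrow> g [^] n = \<one> \<longrightarrow> g = \<one>"
  shows "torsion_free G"
  unfolding torsion_free_def
proof (intro ballI allI impI)
  fix x and k :: nat assume x: "x \<in> carrier G" and k: "0 < k" "x [^] k = \<one>"
  have "int k \<noteq> 0" "x [^] int k = \<one>" using k by (simp_all add: int_pow_int)
  then show "x = \<one>" using assms x by blast
qed

lemma centralizer_subgroup:
  assumes "x \<in> carrier G"
  shows "subgroup {g \<in> carrier G. x \<otimes> g = g \<otimes> x} G"
proof (rule subgroupI)
  fix a assume "a \<in> {g \<in> carrier G. x \<otimes> g = g \<otimes> x}"
  then show "inv a \<in> {g \<in> carrier G. x \<otimes> g = g \<otimes> x}"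
    using assms by simp (metis inv_closed inv_solve_left m_assoc m_closed inv_solve_right)
next
  fix a b assume "a \<in> {g \<in> carrier G. x \<otimes> g = g \<otimes> x}" "b \<in> {g \<in> carrier G. x \<otimes> g = g \<otimes> x}"
  then show "a \<otimes> b \<in> {g \<in> carrier G. x \<otimes> g = g \<otimes> x}"
    using assms by simp (metis m_assoc)
qed (use assms in auto)

lemma center_closed: "x \<in> center G \<Longrightarrow> x \<in> carrier G"
  by (simp add: center_def)

lemma centerD: "x \<in> center G \<Longrightarrow> g \<in> carrier G \<Longrightarrow> x \<otimes> g = g \<otimes> x"
  by (simp add: center_def)

lemma centerI:
  "x \<in> carrier G \<Longrightarrow> (\<And>g. g \<in> carrier G \<Longrightarrow> x \<otimes> g = g \<otimes> x) \<Longrightarrow> x \<in> center G"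
  unfolding center_def by blast

lemma center_subgroup: "subgroup (center G) G"
proof -
  have *: "x \<in> {h \<in> carrier G. g \<otimes> h = h \<otimes> g}" if "x \<in> center G" "g \<in> carrier G" for x g
    using centerD[OF that] center_closed[OF that(1)] by simp
  show ?thesis
  proof (rule subgroupI)
    show "center G \<subseteq> carrier G" using center_closed by blast
    have "\<one> \<in> center G" by (rule centerI) auto
    then show "center G \<noteq> {}" by blast
  next
    fix a assume a: "a \<in> center G"
    show "inv a \<in> center G"
    proof (rule centerI)
      fix g assume g: "g \<in> carrier G"
      show "inv a \<otimes> g = g \<otimes> inv a"
        using subgroup.m_inv_closed[OF centralizer_subgroup[OF g] *[OF a g]] by simp
    qed (use a center_closed in blast)
  next
    fix a b assume ab: "a \<in> center G" "b \<in> center G"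
    show "a \<otimes> b \<in> center G"
    proof (rule centerI)
      fix g assume g: "g \<in> carrier G"
      show "a \<otimes> b \<otimes> g = g \<otimes> (a \<otimes> b)"
        using subgroup.m_closed[OF centralizer_subgroup[OF g] *[OF ab(1) g] *[OF ab(2) g]] by simp
    qed (use ab center_closed in blast)
  qed
qed

lemma center_comm_group: "comm_group (G\<lparr>carrier := center G\<rparr>)"
proof (rule group.group_comm_groupI)
  show "group (G\<lparr>carrier := center G\<rparr>)"
    using subgroup.subgroup_is_group[OF center_subgroup is_group] .
  fix x y assume "x \<in> carrier (G\<lparr>carrier := center G\<rparr>)" "y \<in> carrier (G\<lparr>carrier := center G\<rparr>)"
  then show "x \<otimes>\<^bsub>G\<lparr>carrier := center G\<rparr>\<^esub> y = y \<otimes>\<^bsub>G\<lparr>carrier := center G\<rparr>\<^esub> x"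
    using centerD[of x y] center_closed[of y] by simp
qed

text \<open>The centralizer of \<open>x\<close> is a subgroup, so it is everything as soon as it
  contains the generators.\<close>

lemma in_center_if_commutes_generators:
  assumes S: "S \<subseteq> carrier G" "generate G S = carrier G" and x: "x \<in> carrier G"
    and "\<And>s. s \<in> S \<Longrightarrow> x \<otimes> s = s \<otimes> x"
  shows "x \<in> center G"
proof -
  have "generate G S \<subseteq> {g \<in> carrier G. x \<otimes> g = g \<otimes> x}"
    by (rule generate_subgroup_incl[OF _ centralizer_subgroup[OF x]]) (use assms in auto)
  then show ?thesis using S x by (intro centerI) auto
qed

lemma central_normal:
  assumes "subgroup C G" "C \<subseteq> center G"
  shows "C \<lhd> G"
proof -
  have "x \<otimes> h \<otimes> inv x \<in> C" if "x \<in> carrier G" "h \<in> C" for x h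
  proof -
    have "h \<in> center G" using that assms by blast
    then have hx: "x \<otimes> h = h \<otimes> x" and h: "h \<in> carrier G"
      using that centerD[of h x] center_closed[of h] by auto
    have "x \<otimes> h \<otimes> inv x = h" unfolding hx using that(1) h by (simp add: m_assoc)
    then show ?thesis using that by simp
  qed
  then show ?thesis using assms by (auto simp: normal_inv_iff)
qed

lemma comm_closed [simp]: "g \<in> carrier G \<Longrightarrow> h \<in> carrier G \<Longrightarrow> comm G g h \<in> carrier G"
  by (simp add: comm_def)

lemma mult_comm_eq:
  assumes "g \<in> carrier G" "h \<in> carrier G"
  shows "h \<otimes> g \<otimes> comm G g h = g \<otimes> h"
  using assms by (simp add: comm_def m_assoc) (simp flip: m_assoc)

lemma comm_eq_iff:
  assumes "g \<in> carrier G" "h \<in> carrier G" "c \<in> carrier G"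
  shows "comm G g h = c \<longleftrightarrow> g \<otimes> h = h \<otimes> g \<otimes> c"
  using mult_comm_eq[of g h] assms by (metis comm_closed l_cancel m_closed)

lemma comm_swap:
  assumes "g \<in> carrier G" "h \<in> carrier G"
  shows "comm G h g = inv (comm G g h)"
  using assms by (simp add: comm_def inv_mult_group m_assoc)

end

section \<open>Commutativity of quotients\<close>

context normal
begin

lemma r_coset_eq_iff: "g \<in> carrier G \<Longrightarrow> H #> g = H \<longleftrightarrow> g \<in> H"
  using coset_join1 coset_join2 subgroup_axioms by blast

lemma quotient_kernel: "{g \<in> carrier G. H #> g = \<one>\<^bsub>G Mod H\<^esub>} = H"
  using r_coset_eq_iff subset unfolding one_FactGroup by blast

lemma quotient_group_hom: "group_hom G (G Mod H) (\<lambda>g. H #> g)"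
  using r_coset_hom_Mod factorgroup_is_group is_group
  by (simp add: group_hom_def group_hom_axioms_def)

text \<open>The projection sends \<open>comm G g h\<close> to the commutator of the two cosets,
  which is trivial exactly when they commute.\<close>

lemma quotient_commute_iff:
  assumes "g \<in> carrier G" "h \<in> carrier G"
  shows "(H #> g) \<otimes>\<^bsub>G Mod H\<^esub> (H #> h) = (H #> h) \<otimes>\<^bsub>G Mod H\<^esub> (H #> g) \<longleftrightarrow> comm G g h \<in> H"
proof -
  interpret q: group_hom G "G Mod H" "\<lambda>g. H #> g" by (rule quotient_group_hom)
  have "H #> comm G g h = comm (G Mod H) (H #> g) (H #> h)"
    unfolding comm_def using assms
    by (simp only: q.hom_mult q.hom_inv m_closed inv_closed simp_thms)
  then have "comm G g h \<in> H \<longleftrightarrow> comm (G Mod H) (H #> g) (H #> h) = \<one>\<^bsub>G Mod H\<^esub>"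
    using r_coset_eq_iff[of "comm G g h"] assms by simp
  also have "\<dots> \<longleftrightarrow> (H #> g) \<otimes>\<^bsub>G Mod H\<^esub> (H #> h) = (H #> h) \<otimes>\<^bsub>G Mod H\<^esub> (H #> g)"
    using assms q.H.comm_eq_iff[of "H #> g" "H #> h" "\<one>\<^bsub>G Mod H\<^esub>"] q.hom_closed
    by (metis q.H.m_closed q.H.one_closed q.H.r_one)
  finally show ?thesis by simp
qed

lemma quotient_comm_group_iff:
  "comm_group (G Mod H) \<longleftrightarrow> (\<forall>g\<in>carrier G. \<forall>h\<in>carrier G. comm G g h \<in> H)"
proof
  assume "comm_group (G Mod H)"
  then interpret q: comm_group "G Mod H" .
  interpret h: group_hom G "G Mod H" "\<lambda>g. H #> g" by (rule quotient_group_hom)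
  show "\<forall>g\<in>carrier G. \<forall>h\<in>carrier G. comm G g h \<in> H"
  proof (intro ballI)
    fix g k assume gk: "g \<in> carrier G" "k \<in> carrier G"
    show "comm G g k \<in> H"
      using q.m_comm[OF h.hom_closed[OF gk(1)] h.hom_closed[OF gk(2)]] quotient_commute_iff[OF gk]
      by metis
  qed
next
  assume *: "\<forall>g\<in>carrier G. \<forall>h\<in>carrier G. comm G g h \<in> H"
  show "comm_group (G Mod H)"
  proof (rule group.group_comm_groupI[OF factorgroup_is_group])
    fix x y assume "x \<in> carrier (G Mod H)" "y \<in> carrier (G Mod H)"
    then obtain g h where "g \<in> carrier G" "h \<in> carrier G" "x = H #> g" "y = H #> h"
      by (auto simp: carrier_FactGroup)
    then show "x \<otimes>\<^bsub>G Mod H\<^esub> y = y \<otimes>\<^bsub>G Mod H\<^esub> x"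
      using quotient_commute_iff * by blast
  qed
qed

end

section \<open>Derived subgroup and ordered forms\<close>

lemma (in group) derived_subgroup_least:
  assumes "subgroup C G" "\<forall>g\<in>carrier G. \<forall>h\<in>carrier G. comm G g h \<in> C"
  shows "derived_subgroup G \<subseteq> C"
  unfolding derived_subgroup_def
  by (rule generate_subgroup_incl[OF _ assms(1)]) (use assms(2) in auto)

lemma (in group) derived_subgroup_subgroup: "subgroup (derived_subgroup G) G"
  unfolding derived_subgroup_def by (rule generate_is_subgroup) auto

lemma (in group) comm_in_derived:
  "g \<in> carrier G \<Longrightarrow> h \<in> carrier G \<Longrightarrow> comm G g h \<in> derived_subgroup G"
  unfolding derived_subgroup_def by (rule generate.incl) blast

text \<open>No collection process is needed: the quotient by \<open>C\<close> is generated by the commuting images of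
  the \<open>a i\<close>, hence is abelian and consists of their ordered products.\<close>

lemma (in group) collect:
  assumes a: "\<forall>i<n. a i \<in> carrier G" and c: "\<forall>t<m. c t \<in> carrier G"
    and gen: "generate G (a ` {..<n} \<union> c ` {..<m}) = carrier G"
    and ac: "\<forall>i<n. \<forall>t<m. c t \<otimes> a i = a i \<otimes> c t"
    and cc: "\<forall>s<m. \<forall>t<m. c t \<otimes> c s = c s \<otimes> c t"
    and aa: "\<forall>j<n. \<forall>i<j. comm G (a i) (a j) \<in> range (\<lambda>y. ordprod G c y m)"
  defines "C \<equiv> range (\<lambda>y. ordprod G c y m)"
  shows "\<forall>t<m. c t \<in> center G" "subgroup C G" "C \<subseteq> center G"
    "\<forall>g\<in>carrier G. \<forall>h\<in>carrier G. comm G g h \<in> C"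
    "spans (G Mod C) (carrier (G Mod C)) n (\<lambda>i. C #> a i)"
    "spans G (carrier G) (n + m) (append_fun n a c)"
proof -
  let ?S = "a ` {..<n} \<union> c ` {..<m}"
  let ?Z = "G\<lparr>carrier := center G\<rparr>"
  have S: "?S \<subseteq> carrier G" using a c by auto
  interpret Z: comm_group ?Z by (rule center_comm_group)
  show cZ: "\<forall>t<m. c t \<in> center G"
  proof (intro allI impI)
    fix t assume t: "t < m"
    show "c t \<in> center G"
      by (rule in_center_if_commutes_generators[OF S gen]) (use ac cc c t in auto)
  qed
  have "\<forall>t<m. c t \<in> carrier ?Z" using cZ by simp
  from Z.subgroup_ordprods[OF this] have "subgroup C ?Z"
    by (simp add: C_def ordprod_consistent[OF center_subgroup cZ])
  then show C: "subgroup C G" using incl_subgroup[OF center_subgroup] by blast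
  show CZ: "C \<subseteq> center G" unfolding C_def using ordprod_subgroup[OF center_subgroup cZ] by auto
  interpret C: normal C G by (rule central_normal[OF C CZ])
  interpret q: group_hom G "G Mod C" "\<lambda>g. C #> g" by (rule C.quotient_group_hom)
  \<comment> \<open>The hypothesis covers only \<open>i < j\<close>: diagonal commutators are
    trivial, and swapping the arguments inverts a commutator.\<close>
  have aS: "comm G (a i) (a j) \<in> C" if ij: "i < n" "j < n" for i j
  proof (cases i j rule: linorder_cases)
    case less
    then show ?thesis using aa ij by (simp add: C_def)
  next
    case equal
    then have "comm G (a i) (a j) = \<one>" using a ij by (subst comm_eq_iff) auto
    then show ?thesis using C.one_closed by simp
  next
    case greater
    then have "comm G (a j) (a i) \<in> C" using aa ij by (simp add: C_def)
    then show ?thesis using comm_swap[of "a j" "a i"] a ij by simp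
  qed
  have cC: "c t \<in> C" if t: "t < m" for t
    unfolding C_def using ordprod_unit[of m c t 1] c t by (metis int_pow_1 rangeI)
  have cq: "C #> c t = \<one>\<^bsub>G Mod C\<^esub>" if t: "t < m" for t
    using C.r_coset_eq_iff cC[OF t] c t by simp
  have gq: "generate (G Mod C) ((\<lambda>g. C #> g) ` ?S) = carrier (G Mod C)"
    using q.generate_img[OF S] gen by (simp add: carrier_FactGroup)
  have Sq: "(\<lambda>g. C #> g) ` ?S \<subseteq> carrier (G Mod C)" using S by (auto simp: carrier_FactGroup)
  have comq: "(C #> u) \<otimes>\<^bsub>G Mod C\<^esub> (C #> v) = (C #> v) \<otimes>\<^bsub>G Mod C\<^esub> (C #> u)"
    if "u \<in> ?S" "v \<in> ?S" for u v
  proof -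
    have "u \<in> carrier G" "v \<in> carrier G" using that S by auto
    moreover have "u \<in> a ` {..<n} \<or> C #> u = \<one>\<^bsub>G Mod C\<^esub>" "v \<in> a ` {..<n} \<or> C #> v = \<one>\<^bsub>G Mod C\<^esub>"
      using that cq by auto
    ultimately show ?thesis
      using C.quotient_commute_iff[of u v] aS q.hom_closed q.H.l_one q.H.r_one
      by (elim disjE) (auto simp del: mult_FactGroup one_FactGroup)
  qed
  have cen: "C #> u \<in> center (G Mod C)" if "u \<in> ?S" for u
    by (rule q.H.in_center_if_commutes_generators[OF Sq gq])
      (use that S comq in \<open>auto simp: carrier_FactGroup\<close>)
  have "(\<lambda>g. C #> g) ` ?S \<subseteq> center (G Mod C)" using cen by blast
  from q.H.generate_subgroup_incl[OF this q.H.center_subgroup]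
  have "carrier (G Mod C) \<subseteq> center (G Mod C)" unfolding gq .
  then have Q: "comm_group (G Mod C)"
    using q.H.group_comm_groupI q.H.centerD by (metis subsetD)
  then interpret Q: comm_group "G Mod C" .
  show "\<forall>g\<in>carrier G. \<forall>h\<in>carrier G. comm G g h \<in> C"
    using C.quotient_comm_group_iff Q by blast
  let ?T = "(\<lambda>i. C #> a i) ` {..<n}"
  have T: "?T \<subseteq> carrier (G Mod C)" using a by (auto simp: carrier_FactGroup)
  have ST: "(\<lambda>g. C #> g) ` ?S \<subseteq> generate (G Mod C) ?T"
  proof
    fix x assume "x \<in> (\<lambda>g. C #> g) ` ?S"
    then have "x \<in> ?T \<or> x = \<one>\<^bsub>G Mod C\<^esub>" using cq by auto
    then show "x \<in> generate (G Mod C) ?T" using generate.one generate.incl by metis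
  qed
  from q.H.generate_subgroup_incl[OF ST q.H.generate_is_subgroup[OF T]]
  have "carrier (G Mod C) \<subseteq> generate (G Mod C) ?T" unfolding gq .
  then show sQ: "spans (G Mod C) (carrier (G Mod C)) n (\<lambda>i. C #> a i)"
    using Q.spans_iff_generate[OF q.H.subgroup_self] T q.H.generate_incl[OF T] by blast
  have sC: "spans G C m c" using cC by (auto simp: spans_def C_def)
  show "spans G (carrier G) (n + m) (append_fun n a c)"
    by (rule spans_chain[OF q.H.is_group subgroup_self, where h = "\<lambda>g. C #> g"])
      (use a sQ sC C.quotient_kernel q.homh in \<open>simp_all add: carrier_FactGroup\<close>)
qed

lemma (in comm_group) exists_basis_grp_rank:
  assumes "spans G (carrier G) k b" "torsion_free G"
  shows "\<exists>c. spans G (carrier G) (grp_rank G) c \<and> indep G (grp_rank G) c"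
  using exists_basis[OF subgroup_self torsion_freeD[OF assms(2)] assms(1)] grp_rank_eq by blast

section \<open>Central bases\<close>

lemma (in group_hom) fin_gen_image:
  assumes "fin_gen G" "h ` carrier G = carrier H"
  shows "fin_gen H"
proof -
  obtain S where S: "finite S" "S \<subseteq> carrier G" "generate G S = carrier G"
    using assms(1) by (auto simp: fin_gen_def)
  then have "finite (h ` S)" "h ` S \<subseteq> carrier H" "generate H (h ` S) = carrier H"
    using generate_img[OF S(2)] assms(2) by auto
  then show ?thesis unfolding fin_gen_def by blast
qed

text \<open>Exponents of the commutators are left existential: the numbers \<open>lam\<close> are
  chosen only when a presentation is read off. Pairs are restricted to \<open>i < j\<close> as in
  \<open>rels\<close>.\<close>

definition central_basis ::
  "('a, 'b) monoid_scheme \<Rightarrow> nat \<Rightarrow> nat \<Rightarrow> (nat \<Rightarrow> 'a) \<Rightarrow> (nat \<Rightarrow> 'a) \<Rightarrow> bool" where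
  "central_basis G n m a c \<longleftrightarrow>
     (\<forall>i<n. a i \<in> carrier G) \<and> (\<forall>t<m. c t \<in> center G) \<and>
     (\<forall>j<n. \<forall>i<j. comm G (a i) (a j) \<in> range (\<lambda>y. ordprod G c y m)) \<and>
     spans G (carrier G) (n + m) (append_fun n a c) \<and> indep G (n + m) (append_fun n a c)"

context group
begin

lemma indep_appendD:
  assumes ind: "indep G (k + l) (append_fun k b c)"
    and b: "\<forall>i<k. b i \<in> carrier G" and c: "\<forall>i<l. c i \<in> carrier G"
    and eq: "ordprod G b x k \<otimes> ordprod G c y l = \<one>"
  shows "\<forall>i<k. x i = 0" "\<forall>i<l. y i = 0"
proof -
  have *: "\<forall>i<k + l. append_fun k x y i = 0"
    using ordprod_append[OF b c] eq ind unfolding indep_def by metis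
  show "\<forall>i<k. x i = 0"
  proof (intro allI impI)
    fix i assume "i < k"
    then show "x i = 0" using *[rule_format, of i] by simp
  qed
  show "\<forall>i<l. y i = 0"
  proof (intro allI impI)
    fix i assume "i < l"
    then show "y i = 0" using *[rule_format, of "k + i"] by simp
  qed
qed

lemma spans_append_generate:
  assumes sp: "spans G (carrier G) (n + m) (append_fun n a c)"
    and a: "\<forall>i<n. a i \<in> carrier G" and c: "\<forall>t<m. c t \<in> carrier G"
  shows "generate G (a ` {..<n} \<union> c ` {..<m}) = carrier G"
proof -
  let ?S = "a ` {..<n} \<union> c ` {..<m}"
  have S: "?S \<subseteq> carrier G" using a c by auto
  note g = generate_is_subgroup[OF S]
  have "\<forall>i<n + m. append_fun n a c i \<in> generate G ?S"
    by (auto simp: append_fun_def intro!: generate.incl)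
  from ordprod_subgroup[OF g this] have "carrier G \<subseteq> generate G ?S"
    using spansD(2)[OF sp] by blast
  then show ?thesis using generate_incl[OF S] by blast
qed

text \<open>Conjugation by \<open>h\<close> sends \<open>g\<close> to \<open>g \<otimes> k\<close>
  with \<open>k = comm G g h\<close> central, hence \<open>g [^] n\<close> to
  \<open>g [^] n \<otimes> k [^] n\<close>. As \<open>g [^] n\<close> is central, it is fixed, so
  \<open>k [^] n\<close> is trivial and torsion-freeness gives \<open>k = \<one>\<close>.\<close>

lemma center_isolated:
  assumes tf: "torsion_free G" and ts: "two_step_nilpotent G"
    and g: "g \<in> carrier G" and n: "(n::int) \<noteq> 0" and gn: "g [^] n \<in> center G"
  shows "g \<in> center G"
proof (rule centerI[OF g])
  fix h assume h: "h \<in> carrier G"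
  define k where "k = comm G g h"
  have k: "k \<in> center G" "k \<in> carrier G"
    using ts g h by (auto simp: two_step_nilpotent_def k_def)
  have gh: "g \<otimes> h = h \<otimes> g \<otimes> k" using mult_comm_eq[OF g h] by (simp add: k_def)
  define f where "f x = inv h \<otimes> x \<otimes> h" for x
  have f: "f \<in> hom G G"
  proof (rule homI)
    fix x y assume xy: "x \<in> carrier G" "y \<in> carrier G"
    have "h \<otimes> (inv h \<otimes> (y \<otimes> h)) = y \<otimes> h" using h xy by (simp add: m_assoc[symmetric])
    then show "f (x \<otimes> y) = f x \<otimes> f y" using h xy by (simp add: f_def m_assoc)
  qed (use h in \<open>simp add: f_def\<close>)
  have "f g = g \<otimes> k"
    using g h k(2) gh by (simp add: f_def m_assoc inv_solve_left')
  then have "f (g [^] n) = (g \<otimes> k) [^] n"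
    using hom_int_pow[OF f g is_group is_group] by simp
  also have "\<dots> = g [^] n \<otimes> k [^] n"
    using int_pow_mult_distrib[OF _ g k(2)] centerD[OF k(1) g] by simp
  also have "f (g [^] n) = g [^] n"
    using centerD[OF gn h] g h by (simp add: f_def m_assoc) (simp add: m_assoc[symmetric])
  finally have "k [^] n = \<one>" using g k(2) by (simp add: l_cancel_one')
  then have "k = \<one>" using torsion_freeD[OF tf] k(2) n by blast
  then show "g \<otimes> h = h \<otimes> g" using gh g h by simp
qed

text \<open>A coset with a trivial nonzero power is represented by an element having a central
  power, which is itself central by \<open>center_isolated\<close>. So \<open>G/Z(G)\<close> is an
  abelian group to which \<open>exists_basis\<close> can be applied.\<close>

lemma quotient_center:
  assumes ts: "two_step_nilpotent G"
  shows "center G \<lhd> G" "comm_group (G Mod center G)"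
    "torsion_free G \<Longrightarrow> torsion_free (G Mod center G)"
proof -
  show n: "center G \<lhd> G" by (rule central_normal[OF center_subgroup]) simp
  interpret N: normal "center G" G by (rule n)
  interpret q: group_hom G "G Mod center G" "\<lambda>g. center G #> g" by (rule N.quotient_group_hom)
  show "comm_group (G Mod center G)"
    using N.quotient_comm_group_iff ts by (simp add: two_step_nilpotent_def)
  assume tf: "torsion_free G"
  show "torsion_free (G Mod center G)"
  proof (rule q.H.torsion_freeI, intro ballI allI impI)
    fix x and k :: int
    assume "x \<in> carrier (G Mod center G)" and k: "k \<noteq> 0" and xk: "x [^]\<^bsub>G Mod center G\<^esub> k = \<one>\<^bsub>G Mod center G\<^esub>"
    then obtain g where g: "g \<in> carrier G" "x = center G #> g" by (auto simp: carrier_FactGroup)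
    have "center G #> (g [^] k) = center G" using q.hom_int_pow[OF g(1), of k] xk g(2) by simp
    then have "g [^] k \<in> center G" using N.r_coset_eq_iff g(1) by simp
    then have "g \<in> center G" by (rule center_isolated[OF tf ts g(1) k])
    then show "x = \<one>\<^bsub>G Mod center G\<^esub>" using N.r_coset_eq_iff g by simp
  qed
qed

lemma derived_subset_center:
  assumes "two_step_nilpotent G"
  shows "derived_subgroup G \<subseteq> center G"
  using derived_subgroup_least[OF center_subgroup] assms by (simp add: two_step_nilpotent_def)

lemma central_subgroup_rank_le:
  assumes C: "subgroup C G" "C \<subseteq> D" and D: "subgroup D G" "D \<subseteq> center G" and s: "spans G D k b"
  shows "grp_rank (G\<lparr>carrier := C\<rparr>) \<le> k" "\<exists>c. spans G C k c"
proof -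
  let ?Z = "G\<lparr>carrier := center G\<rparr>"
  interpret Z: comm_group ?Z by (rule center_comm_group)
  have CZ: "subgroup C ?Z" "subgroup D ?Z"
    using subgroup_incl[OF _ center_subgroup] C D by blast+
  have "spans ?Z D k b" using spans_consistent[OF center_subgroup D(2)] s by blast
  then obtain c where c: "spans ?Z C k c" using Z.spans_subgroup[OF CZ(2) _ CZ(1) C(2)] by blast
  then have c': "spans G C k c" using spans_consistent[OF center_subgroup] C D by blast
  then show "\<exists>c. spans G C k c" by blast
  interpret C: comm_group "G\<lparr>carrier := C\<rparr>"
    using Z.subgroup_is_comm_group[OF CZ(1)] by simp
  have "spans (G\<lparr>carrier := C\<rparr>) C k c" using spans_consistent[OF C(1)] c' by blast
  then show "grp_rank (G\<lparr>carrier := C\<rparr>) \<le> k" using C.grp_rank_le[of k c] by simp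
qed

text \<open>Writing \<open>Z\<close> for the center and \<open>C\<close> for the span of \<open>c\<close>, the group \<open>Z/C\<close> is free abelian
  of some rank \<open>r\<close> because it embeds into \<open>G/C\<close>. Hence \<open>Z\<close> has rank \<open>r + m\<close>, and \<open>G/C\<close>, of rank \<open>n\<close>,
  is an extension of \<open>G/Z\<close> by \<open>Z/C\<close>.\<close>

lemma central_basis_imp:
  assumes cb: "central_basis G n m a c"
  shows "fin_gen G" "torsion_free G" "two_step_nilpotent G"
    "grp_rank (G Mod center G) + grp_rank (G\<lparr>carrier := center G\<rparr>) = n + m"
    "grp_rank (G\<lparr>carrier := derived_subgroup G\<rparr>) \<le> m"
    "m \<le> grp_rank (G\<lparr>carrier := center G\<rparr>)"
proof -
  let ?Z = "G\<lparr>carrier := center G\<rparr>"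
  define C where "C = range (\<lambda>y. ordprod G c y m)"
  have a: "\<forall>i<n. a i \<in> carrier G" and cZ: "\<forall>t<m. c t \<in> center G"
    and aa: "\<forall>j<n. \<forall>i<j. comm G (a i) (a j) \<in> range (\<lambda>y. ordprod G c y m)"
    and sp: "spans G (carrier G) (n + m) (append_fun n a c)"
    and ind: "indep G (n + m) (append_fun n a c)"
    using cb by (auto simp: central_basis_def)
  have c: "\<forall>t<m. c t \<in> carrier G" using cZ center_closed by blast
  note gen = spans_append_generate[OF sp a c]
  have "finite (a ` {..<n} \<union> c ` {..<m})" "a ` {..<n} \<union> c ` {..<m} \<subseteq> carrier G"
    using a c by auto
  then show "fin_gen G" using gen unfolding fin_gen_def by blast
  have ac: "\<forall>i<n. \<forall>t<m. c t \<otimes> a i = a i \<otimes> c t" "\<forall>s<m. \<forall>t<m. c t \<otimes> c s = c s \<otimes> c t"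
    using cZ a c centerD by metis+
  note col = collect[OF a c gen ac aa, folded C_def]
  interpret C: normal C G by (rule central_normal[OF col(2,3)])
  interpret q: group_hom G "G Mod C" "\<lambda>g. C #> g" by (rule C.quotient_group_hom)
  interpret Q: comm_group "G Mod C" using C.quotient_comm_group_iff col(4) by blast
  interpret Z: comm_group ?Z by (rule center_comm_group)
  show ts: "two_step_nilpotent G" using col(3,4) by (auto simp: two_step_nilpotent_def)
  have indC: "indep G m c"
    using indep_appendD(2)[OF ind a c, of "\<lambda>_. 0"] ordprod_zero[of n "\<lambda>_. 0" a] c
    by (simp add: indep_def)
  \<comment> \<open>A product of the \<open>a\<close>'s that falls into \<open>C\<close> can be
    cancelled by a product of the \<open>c\<close>'s, and joint independence then makes its
    exponents vanish.\<close>
  have indQ: "indep (G Mod C) n (\<lambda>i. C #> a i)"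
    unfolding indep_def
  proof (rule allI, rule impI)
    fix x assume "ordprod (G Mod C) (\<lambda>i. C #> a i) x n = \<one>\<^bsub>G Mod C\<^esub>"
    then have "C #> ordprod G a x n = C"
      using ordprod_hom[OF q.H.is_group q.homh a, of x] by simp
    then have "ordprod G a x n \<in> C" using C.r_coset_eq_iff a by simp
    then have "inv (ordprod G a x n) \<in> C" by (rule C.m_inv_closed)
    then obtain y where "inv (ordprod G a x n) = ordprod G c y m" by (auto simp: C_def)
    then have "ordprod G a x n \<otimes> ordprod G c y m = \<one>" using a by (metis ordprod_closed r_inv)
    then show "\<forall>i<n. x i = 0" by (rule indep_appendD(1)[OF ind a c])
  qed
  have sC: "spans G C m c"
    unfolding C_def by (rule spans_ordprods[OF c])
  have CZ: "subgroup C ?Z" using subgroup_incl[OF col(2) center_subgroup col(3)] .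
  have sCZ: "spans ?Z C m c" "indep ?Z m c"
    using spans_consistent[OF center_subgroup col(3)] sC indep_consistent[OF center_subgroup cZ] indC
    by blast+
  \<comment> \<open>Both \<open>G/C\<close> and \<open>C\<close> have bases, hence no torsion: a
    torsion element of \<open>G\<close> first dies in \<open>G/C\<close>, thus lies in
    \<open>C\<close>, and is trivial there.\<close>
  show tf: "torsion_free G"
  proof (rule torsion_freeI, intro ballI allI impI)
    fix g and k :: int assume g: "g \<in> carrier G" and k: "k \<noteq> 0" "g [^] k = \<one>"
    have "(C #> g) [^]\<^bsub>G Mod C\<^esub> k = \<one>\<^bsub>G Mod C\<^esub>"
      using q.hom_int_pow[OF g, of k] k(2) q.hom_one by simp
    then have "C #> g = \<one>\<^bsub>G Mod C\<^esub>"
      using Q.basis_torsion_free[OF q.H.subgroup_self col(5) indQ] g k(1) q.hom_closed by blast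
    then have gC: "g \<in> C" using C.r_coset_eq_iff[OF g] by simp
    then have "g \<in> center G" using col(3) by blast
    then have "g [^]\<^bsub>?Z\<^esub> k = \<one>\<^bsub>?Z\<^esub>"
      using int_pow_consistent[OF center_subgroup, of g k] k(2) by simp
    then have "g = \<one>\<^bsub>?Z\<^esub>" using Z.basis_torsion_free[OF CZ sCZ] k(1) gC by blast
    then show "g = \<one>" by simp
  qed
  define D where "D = (\<lambda>g. C #> g) ` center G"
  have D: "subgroup D (G Mod C)"
    unfolding D_def using q.subgroup_img_is_subgroup[OF center_subgroup] .
  have tfQ: "\<forall>g\<in>carrier (G Mod C). \<forall>n::int. n \<noteq> 0 \<longrightarrow> g [^]\<^bsub>G Mod C\<^esub> n = \<one>\<^bsub>G Mod C\<^esub> \<longrightarrow> g = \<one>\<^bsub>G Mod C\<^esub>"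
    by (rule Q.basis_torsion_free[OF q.H.subgroup_self col(5) indQ])
  have Dsub: "D \<subseteq> carrier (G Mod C)" using subgroup.subset[OF D] .
  obtain d0 where "spans (G Mod C) D n d0"
    using Q.spans_subgroup[OF q.H.subgroup_self col(5) D Dsub] by blast
  then obtain r d where rd: "spans (G Mod C) D r d" "indep (G Mod C) r d"
    using Q.exists_basis[OF D] tfQ Dsub by blast
  \<comment> \<open>The basis \<open>d\<close> of the image of the center in \<open>G/C\<close> is
    lifted to central representatives, to be stacked on top of \<open>c\<close>.\<close>
  have "\<forall>i. \<exists>z. i < r \<longrightarrow> z \<in> center G \<and> d i = C #> z"
    using spansD(1)[OF rd(1)] by (auto simp: D_def)
  then obtain z where z: "\<forall>i<r. z i \<in> center G" "\<And>i. i < r \<Longrightarrow> d i = C #> z i" by metis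
  have dz: "spans (G Mod C) D r (\<lambda>i. C #> z i)" "indep (G Mod C) r (\<lambda>i. C #> z i)"
    using rd spans_cong[of r d "\<lambda>i. C #> z i"] indep_cong[of r d "\<lambda>i. C #> z i"] z(2) by blast+
  have hZ: "(\<lambda>g. C #> g) \<in> hom ?Z (G Mod C)"
    using q.homh center_closed by (auto simp: hom_def Pi_def)
  have kerZ: "{g \<in> center G. C #> g = \<one>\<^bsub>G Mod C\<^esub>} = C"
    using C.quotient_kernel col(3) center_closed by blast
  have bZ: "spans G (center G) (r + m) (append_fun r z c)"
    by (rule spans_chain[OF q.H.is_group center_subgroup hZ z(1)])
      (use dz sC kerZ in \<open>simp_all add: D_def del: one_FactGroup\<close>)
  have iZ: "indep G (r + m) (append_fun r z c)"
  proof (rule indep_chain[OF q.H.is_group center_subgroup hZ z(1) dz(2) cZ _ indC])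
    fix i assume "i < m"
    then have "c i \<in> C" using spansD(1)[OF sC] by blast
    then show "C #> c i = \<one>\<^bsub>G Mod C\<^esub>" using C.r_coset_eq_iff by simp
  qed
  have zc: "\<forall>i<r + m. append_fun r z c i \<in> center G" using spansD(1)[OF bZ] .
  have rZ: "grp_rank ?Z = r + m"
    using Z.grp_rank_eq[of "r + m" "append_fun r z c"] bZ iZ
      spans_consistent[OF center_subgroup order_refl] indep_consistent[OF center_subgroup zc]
    by simp
  then show "m \<le> grp_rank ?Z" by simp
  interpret N: normal "center G" G by (rule quotient_center(1)[OF ts])
  interpret p: group_hom G "G Mod center G" "\<lambda>g. center G #> g" by (rule N.quotient_group_hom)
  interpret P: comm_group "G Mod center G" by (rule quotient_center(2)[OF ts])
  have pim: "(\<lambda>g. center G #> g) ` carrier G = carrier (G Mod center G)"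
    by (simp add: carrier_FactGroup)
  have fgP: "fin_gen (G Mod center G)"
    by (rule p.fin_gen_image[OF \<open>fin_gen G\<close> pim])
  then obtain e where e: "spans (G Mod center G) (carrier (G Mod center G)) (grp_rank (G Mod center G)) e"
      "indep (G Mod center G) (grp_rank (G Mod center G)) e"
    using P.exists_basis_grp_rank P.spans_grp_rank quotient_center(3)[OF ts tf] by blast
  define s where "s = grp_rank (G Mod center G)"
  have "\<forall>i. \<exists>g. i < s \<longrightarrow> g \<in> carrier G \<and> e i = center G #> g"
    using spansD(1)[OF e(1)] by (auto simp: carrier_FactGroup s_def)
  then obtain g where g: "\<And>i. i < s \<Longrightarrow> g i \<in> carrier G" "\<And>i. i < s \<Longrightarrow> e i = center G #> g i"
    by metis
  \<comment> \<open>The projection from \<open>G/C\<close> onto \<open>G/Z(G)\<close> exists since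
    \<open>C\<close> is contained in the center. Its kernel is \<open>D\<close>, so lifts of
    \<open>e\<close> followed by \<open>d\<close> give a second basis of \<open>G/C\<close>, to be
    compared with the \<open>n\<close> cosets of the \<open>a\<close>'s.\<close>
  obtain \<rho> where \<rho>: "\<rho> \<in> hom (G Mod C) (G Mod center G)"
    "\<And>x. x \<in> carrier G \<Longrightarrow> \<rho> (C #> x) = center G #> x"
  proof (rule FactGroup_universal[OF p.homh C.normal_axioms])
    fix x y assume xy: "x \<in> carrier G" "y \<in> carrier G" "C #> x = C #> y"
    then have "y \<in> C #> x" using repr_independenceD col(2) by blast
    then have "y \<in> center G #> x" using col(3) by (auto simp: r_coset_def)
    then show "center G #> x = center G #> y"
      using repr_independence[OF _ xy(1) center_subgroup] by blast
  qed blast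
  have ge: "\<rho> (C #> g i) = e i" if "i < s" for i using \<rho>(2) g that by simp
  have \<rho>im: "\<rho> ` carrier (G Mod C) = carrier (G Mod center G)"
    by (auto simp: carrier_FactGroup \<rho>(2) image_image)
  have gQ: "\<forall>i<s. C #> g i \<in> carrier (G Mod C)" using g(1) by (auto simp: carrier_FactGroup)
  have e': "spans (G Mod center G) (carrier (G Mod center G)) s (\<lambda>i. \<rho> (C #> g i))"
    "indep (G Mod center G) s (\<lambda>i. \<rho> (C #> g i))"
    using e spans_cong[of s e "\<lambda>i. \<rho> (C #> g i)"] indep_cong[of s e "\<lambda>i. \<rho> (C #> g i)"] ge
    unfolding s_def by metis+
  have ker: "{x \<in> carrier (G Mod C). \<rho> x = \<one>\<^bsub>G Mod center G\<^esub>} = D"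
  proof -
    have "\<rho> (C #> x) = \<one>\<^bsub>G Mod center G\<^esub> \<longleftrightarrow> x \<in> center G" if "x \<in> carrier G" for x
      using \<rho>(2)[OF that] N.r_coset_eq_iff[OF that] by simp
    then show ?thesis
      using center_closed unfolding carrier_FactGroup D_def by blast
  qed
  have D1: "\<forall>i<r. \<rho> (d i) = \<one>\<^bsub>G Mod center G\<^esub>" "\<forall>i<r. d i \<in> carrier (G Mod C)"
    using spansD(1)[OF rd(1)] ker by blast+
  have \<rho>': "\<rho> \<in> hom ((G Mod C)\<lparr>carrier := carrier (G Mod C)\<rparr>) (G Mod center G)"
    using \<rho>(1) by simp
  have "spans (G Mod C) (carrier (G Mod C)) (s + r) (append_fun s (\<lambda>i. C #> g i) d)"
    by (rule q.H.spans_chain[OF p.H.is_group q.H.subgroup_self \<rho>' gQ])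
      (simp_all only: \<rho>im ker e' rd)
  moreover have "indep (G Mod C) (s + r) (append_fun s (\<lambda>i. C #> g i) d)"
    by (rule q.H.indep_chain[OF p.H.is_group q.H.subgroup_self \<rho>' gQ e'(2) D1(2) _ rd(2)])
      (use D1(1) in blast)
  ultimately have "n = s + r"
    using Q.basis_card_unique[OF q.H.subgroup_self col(5) indQ] by blast
  then show "grp_rank (G Mod center G) + grp_rank ?Z = n + m" using rZ by (simp add: s_def)
  show "grp_rank (G\<lparr>carrier := derived_subgroup G\<rparr>) \<le> m"
    using central_subgroup_rank_le(1)[OF derived_subgroup_subgroup _ col(2,3) sC]
      derived_subgroup_least[OF col(2,4)] by blast
qed

section \<open>From the rank conditions to a central basis\<close>

lemma finite_imp_image_lessThan:
  assumes "finite S"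
  shows "\<exists>f (n::nat). S = f ` {..<n}"
proof -
  obtain f where "bij_betw f {0..<card S} S" using ex_bij_betw_nat_finite[OF assms] by blast
  then have "S = f ` {..<card S}" by (simp add: bij_betw_def atLeast0LessThan)
  then show ?thesis by blast
qed

text \<open>Let \<open>C\<close> be generated by the finitely many commutators of generators. Modulo
  \<open>C\<close> the group is abelian and finitely generated, so the image of the center is
  finitely generated; the kernel of this projection on the center is \<open>C\<close>, which is
  finitely generated too.\<close>

lemma center_spanned:
  assumes fg: "fin_gen G" and ts: "two_step_nilpotent G"
  shows "\<exists>k b. spans G (center G) k b"
proof -
  obtain S where S: "finite S" "S \<subseteq> carrier G" "generate G S = carrier G"
    using fg by (auto simp: fin_gen_def)
  define T where "T = (\<lambda>(s, t). comm G s t) ` (S \<times> S)"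
  have "finite T" using S(1) by (simp add: T_def)
  obtain a and n :: nat where a: "S = a ` {..<n}"
    using finite_imp_image_lessThan[OF S(1)] by blast
  obtain c and m :: nat where c: "T = c ` {..<m}"
    using finite_imp_image_lessThan[OF \<open>finite T\<close>] by blast
  define C where "C = range (\<lambda>y. ordprod G c y m)"
  have TZ: "T \<subseteq> center G" using ts S(2) by (auto simp: T_def two_step_nilpotent_def)
  have aG: "\<forall>i<n. a i \<in> carrier G" and cZ: "\<forall>t<m. c t \<in> center G"
    using S(2) TZ a c by auto
  then have cG: "\<forall>t<m. c t \<in> carrier G" using center_closed by blast
  have "S \<union> T \<subseteq> carrier G" using S(2) TZ center_closed by auto
  then have gen: "generate G (a ` {..<n} \<union> c ` {..<m}) = carrier G"
    using mono_generate[of S "S \<union> T"] S(3) generate_incl[of "S \<union> T"] a c by auto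
  have com: "\<forall>i<n. \<forall>t<m. c t \<otimes> a i = a i \<otimes> c t" "\<forall>s<m. \<forall>t<m. c t \<otimes> c s = c s \<otimes> c t"
    using cZ aG cG centerD by metis+
  have sC: "spans G C m c" unfolding C_def by (rule spans_ordprods[OF cG])
  then have TC: "T \<subseteq> C" using c spansD(1) by fastforce
  have aa: "\<forall>j<n. \<forall>i<j. comm G (a i) (a j) \<in> range (\<lambda>y. ordprod G c y m)"
  proof (intro allI impI)
    fix j i assume "j < n" "i < j"
    then have "a i \<in> S" "a j \<in> S" using a by auto
    then have "comm G (a i) (a j) \<in> T" unfolding T_def by force
    then show "comm G (a i) (a j) \<in> range (\<lambda>y. ordprod G c y m)"
      using TC by (auto simp: C_def)
  qed
  note col = collect[OF aG cG gen com aa, folded C_def]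
  interpret C: normal C G by (rule central_normal[OF col(2,3)])
  interpret q: group_hom G "G Mod C" "\<lambda>g. C #> g" by (rule C.quotient_group_hom)
  interpret Q: comm_group "G Mod C" using C.quotient_comm_group_iff col(4) by blast
  have D: "subgroup ((\<lambda>g. C #> g) ` center G) (G Mod C)"
    using q.subgroup_img_is_subgroup[OF center_subgroup] .
  then obtain d where d: "spans (G Mod C) ((\<lambda>g. C #> g) ` center G) n d"
    using Q.spans_subgroup[OF q.H.subgroup_self col(5)] subgroup.subset by blast
  have "\<forall>i. \<exists>z. i < n \<longrightarrow> z \<in> center G \<and> d i = C #> z"
    using spansD(1)[OF d] by auto
  then obtain z where z: "\<forall>i<n. z i \<in> center G" "\<And>i. i < n \<Longrightarrow> d i = C #> z i" by metis
  have dz: "spans (G Mod C) ((\<lambda>g. C #> g) ` center G) n (\<lambda>i. C #> z i)"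
    using d spans_cong[of n d "\<lambda>i. C #> z i"] z(2) by blast
  have hZ: "(\<lambda>g. C #> g) \<in> hom (G\<lparr>carrier := center G\<rparr>) (G Mod C)"
    using q.homh center_closed by (auto simp: hom_def Pi_def)
  have kerZ: "{g \<in> center G. C #> g = \<one>\<^bsub>G Mod C\<^esub>} = C"
    using C.quotient_kernel col(3) center_closed by blast
  have "spans G (center G) (n + m) (append_fun n z c)"
    by (rule spans_chain[OF q.H.is_group center_subgroup hZ z(1) dz]) (use sC kerZ in simp)
  then show ?thesis by blast
qed

lemma imp_central_basis:
  assumes fg: "fin_gen G" and tf: "torsion_free G" and ts: "two_step_nilpotent G"
    and nm: "grp_rank (G Mod center G) + grp_rank (G\<lparr>carrier := center G\<rparr>) = n + m"
    and m1: "grp_rank (G\<lparr>carrier := derived_subgroup G\<rparr>) \<le> m"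
    and m2: "m \<le> grp_rank (G\<lparr>carrier := center G\<rparr>)"
  shows "\<exists>a c. central_basis G n m a c"
proof -
  let ?Z = "G\<lparr>carrier := center G\<rparr>" and ?D = "derived_subgroup G"
  define p where "p = grp_rank (G Mod center G)"
  define q where "q = grp_rank ?Z"
  interpret N: normal "center G" G by (rule quotient_center(1)[OF ts])
  interpret p: group_hom G "G Mod center G" "\<lambda>g. center G #> g" by (rule N.quotient_group_hom)
  interpret P: comm_group "G Mod center G" by (rule quotient_center(2)[OF ts])
  interpret Z: comm_group ?Z by (rule center_comm_group)
  have pim: "(\<lambda>g. center G #> g) ` carrier G = carrier (G Mod center G)"
    by (simp add: carrier_FactGroup)
  obtain e where e: "spans (G Mod center G) (carrier (G Mod center G)) p e" "indep (G Mod center G) p e"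
    using P.exists_basis_grp_rank P.spans_grp_rank p.fin_gen_image[OF fg pim]
      quotient_center(3)[OF ts tf] unfolding p_def by blast
  have "\<forall>i. \<exists>g. i < p \<longrightarrow> g \<in> carrier G \<and> e i = center G #> g"
    using spansD(1)[OF e(1)] by (auto simp: carrier_FactGroup)
  then obtain g where g: "\<forall>i<p. g i \<in> carrier G" "\<And>i. i < p \<Longrightarrow> e i = center G #> g i"
    by metis
  have e': "spans (G Mod center G) (carrier (G Mod center G)) p (\<lambda>i. center G #> g i)"
    "indep (G Mod center G) p (\<lambda>i. center G #> g i)"
    using e spans_cong[of p e "\<lambda>i. center G #> g i"] indep_cong[of p e "\<lambda>i. center G #> g i"] g(2)
    by metis+
  obtain z0 k0 where z0: "spans G (center G) k0 z0" using center_spanned[OF fg ts] by blast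
  have DZ: "?D \<subseteq> center G" by (rule derived_subset_center[OF ts])
  have D: "subgroup ?D ?Z" by (rule subgroup_incl[OF derived_subgroup_subgroup center_subgroup DZ])
  have zpow: "z [^]\<^bsub>?Z\<^esub> k = z [^] k" if "z \<in> center G" for z and k :: int
    using int_pow_consistent[OF center_subgroup that] by simp
  have tfZ: "torsion_free ?Z"
  proof (rule Z.torsion_freeI, intro ballI allI impI)
    fix u and k :: int assume u: "u \<in> carrier ?Z" and k: "k \<noteq> 0" "u [^]\<^bsub>?Z\<^esub> k = \<one>\<^bsub>?Z\<^esub>"
    then have "u [^] k = \<one>" using zpow[of u k] by simp
    moreover have "u \<in> carrier G" using u center_closed by simp
    ultimately have "u = \<one>" using torsion_freeD[OF tf] k(1) by blast
    then show "u = \<one>\<^bsub>?Z\<^esub>" by simp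
  qed
  \<comment> \<open>This is the isolator of the derived subgroup. Powers are taken in
    \<open>?Z\<close>, so that the laws of abelian groups apply to them directly.\<close>
  define I where "I = {z \<in> center G. \<exists>k::int. k \<noteq> 0 \<and> z [^]\<^bsub>?Z\<^esub> k \<in> ?D}"
  have I: "subgroup I ?Z"
  proof (rule Z.subgroupI)
    show "I \<subseteq> carrier ?Z" by (auto simp: I_def)
    have "\<one> \<in> I" using subgroup.one_closed[OF D] subgroup.one_closed[OF center_subgroup]
      Z.int_pow_1[OF Z.one_closed] by (auto simp: I_def intro!: exI[where x = 1])
    then show "I \<noteq> {}" by blast
  next
    fix u assume u: "u \<in> I"
    then obtain k :: int where k: "k \<noteq> 0" "u [^]\<^bsub>?Z\<^esub> k \<in> ?D" and uZ: "u \<in> carrier ?Z"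
      by (auto simp: I_def)
    have "inv\<^bsub>?Z\<^esub> u [^]\<^bsub>?Z\<^esub> k \<in> ?D"
      using Z.int_pow_inv[OF uZ, of k] subgroup.m_inv_closed[OF D k(2)] by simp
    then show "inv\<^bsub>?Z\<^esub> u \<in> I" using k(1) Z.inv_closed[OF uZ] by (auto simp: I_def)
  next
    fix u v assume "u \<in> I" "v \<in> I"
    then obtain k l :: int where kl: "k \<noteq> 0" "u [^]\<^bsub>?Z\<^esub> k \<in> ?D" "l \<noteq> 0" "v [^]\<^bsub>?Z\<^esub> l \<in> ?D"
      and uv: "u \<in> carrier ?Z" "v \<in> carrier ?Z"
      by (auto simp: I_def)
    \<comment> \<open>The product \<open>k * l\<close> serves as a common exponent, and it is
      nonzero again.\<close>
    have "(u \<otimes>\<^bsub>?Z\<^esub> v) [^]\<^bsub>?Z\<^esub> (k * l) = (u [^]\<^bsub>?Z\<^esub> k) [^]\<^bsub>?Z\<^esub> l \<otimes>\<^bsub>?Z\<^esub> (v [^]\<^bsub>?Z\<^esub> l) [^]\<^bsub>?Z\<^esub> k"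
      using uv by (simp only: Z.int_pow_distrib Z.int_pow_pow mult.commute[of l k])
    also have "\<dots> \<in> ?D"
      using kl Z.subgroup_int_pow_closed[OF D] subgroup.m_closed[OF D] by blast
    finally show "u \<otimes>\<^bsub>?Z\<^esub> v \<in> I"
      using kl(1,3) Z.m_closed[OF uv] by (auto simp: I_def intro!: exI[of _ "k * l"])
  qed
  have IZ: "I \<subseteq> center G" by (auto simp: I_def)
  have DI: "?D \<subseteq> I"
  proof
    fix u assume u: "u \<in> ?D"
    then have "u [^]\<^bsub>?Z\<^esub> (1::int) \<in> ?D" using DZ Z.int_pow_1[of u] by auto
    then show "u \<in> I" using u DZ unfolding I_def by (metis (mono_tags, lifting) mem_Collect_eq subsetD zero_neq_one)
  qed
  have z0Z: "spans ?Z (carrier ?Z) k0 z0" using spans_consistent[OF center_subgroup order_refl] z0 by simp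
  then obtain i0 where i0: "spans ?Z I k0 i0"
    using Z.spans_subgroup[OF Z.subgroup_self z0Z I subgroup.subset[OF I]] by blast
  obtain r i where ri: "spans ?Z I r i" "indep ?Z r i"
    using Z.exists_basis[OF I _ i0] Z.torsion_freeD[OF tfZ] IZ by auto
  have iI: "\<forall>j<r. i j \<in> I" using spansD(1)[OF ri(1)] .
  then have iZ: "\<forall>j<r. i j \<in> carrier ?Z" using IZ by auto
  \<comment> \<open>Each basis element of \<open>I\<close> has a nonzero power in the derived
    subgroup. These \<open>r\<close> powers remain independent, so \<open>r\<close> is at most the
    rank of the derived subgroup.\<close>
  have rm: "r \<le> m"
  proof -
    have "\<forall>j. \<exists>k::int. j < r \<longrightarrow> k \<noteq> 0 \<and> i j [^]\<^bsub>?Z\<^esub> k \<in> ?D" using iI by (auto simp: I_def)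
    then obtain k :: "nat \<Rightarrow> int" where k: "\<And>j. j < r \<Longrightarrow> k j \<noteq> 0" "\<forall>j<r. i j [^]\<^bsub>?Z\<^esub> k j \<in> ?D"
      by metis
    have ind: "indep ?Z r (\<lambda>j. i j [^]\<^bsub>?Z\<^esub> k j)"
      unfolding indep_def
    proof (rule allI, rule impI)
      fix x assume "ordprod ?Z (\<lambda>j. i j [^]\<^bsub>?Z\<^esub> k j) x r = \<one>\<^bsub>?Z\<^esub>"
      then have "ordprod ?Z i (\<lambda>j. k j * x j) r = \<one>\<^bsub>?Z\<^esub>"
        by (simp only: Z.ordprod_base_pow[where b = i and e = k and x = x, OF iZ])
      then have "\<forall>j<r. k j * x j = 0" using ri(2) unfolding indep_def by blast
      then show "\<forall>j<r. x j = 0" using k(1) by simp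
    qed
    obtain w0 where w0: "spans ?Z ?D k0 w0"
      using Z.spans_subgroup[OF Z.subgroup_self z0Z D] DZ by auto
    interpret D: comm_group "G\<lparr>carrier := ?D\<rparr>" using Z.subgroup_is_comm_group[OF D] by simp
    have "spans (G\<lparr>carrier := ?D\<rparr>) ?D k0 w0"
      using spans_consistent[OF derived_subgroup_subgroup order_refl] spans_consistent[OF center_subgroup DZ] w0
      by blast
    then obtain w where "spans (G\<lparr>carrier := ?D\<rparr>) ?D (grp_rank (G\<lparr>carrier := ?D\<rparr>)) w"
      using D.spans_grp_rank D.spans_imp_fin_gen[of k0 w0] by auto
    then have "spans ?Z ?D (grp_rank (G\<lparr>carrier := ?D\<rparr>)) w"
      using spans_consistent[OF derived_subgroup_subgroup order_refl] spans_consistent[OF center_subgroup DZ]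
      by blast
    then have "r \<le> grp_rank (G\<lparr>carrier := ?D\<rparr>)"
      using Z.indep_le_spans[OF k(2) ind _ D] by blast
    then show ?thesis using m1 by simp
  qed
  interpret I: normal I ?Z using I Z.normal_iff_subgroup by blast
  interpret Zq: group_hom ?Z "?Z Mod I" "\<lambda>z. I #>\<^bsub>?Z\<^esub> z" by (rule I.quotient_group_hom)
  interpret ZI: comm_group "?Z Mod I" by (rule Z.abelian_FactGroup[OF I])
  \<comment> \<open>\<open>I\<close> is isolated: if \<open>u\<close> to the power \<open>k\<close>
    lies in \<open>I\<close>, then a further power \<open>k * l\<close> lies in the derived
    subgroup, so \<open>u\<close> itself belongs to \<open>I\<close>.\<close>
  have tfZI: "torsion_free (?Z Mod I)"
  proof (rule Zq.H.torsion_freeI, intro ballI allI impI)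
    fix x and k :: int
    assume "x \<in> carrier (?Z Mod I)" and k: "k \<noteq> 0" and xk: "x [^]\<^bsub>?Z Mod I\<^esub> k = \<one>\<^bsub>?Z Mod I\<^esub>"
    then obtain u where u: "u \<in> carrier ?Z" "x = I #>\<^bsub>?Z\<^esub> u" by (auto simp: carrier_FactGroup)
    have "I #>\<^bsub>?Z\<^esub> (u [^]\<^bsub>?Z\<^esub> k) = I" using Zq.hom_int_pow[OF u(1), of k] xk u(2) by simp
    then have "u [^]\<^bsub>?Z\<^esub> k \<in> I" using I.r_coset_eq_iff Z.int_pow_closed[OF u(1)] by blast
    then obtain l :: int where "l \<noteq> 0" "(u [^]\<^bsub>?Z\<^esub> k) [^]\<^bsub>?Z\<^esub> l \<in> ?D" by (auto simp: I_def)
    then have "k * l \<noteq> 0" "u [^]\<^bsub>?Z\<^esub> (k * l) \<in> ?D" using k Z.int_pow_pow[OF u(1)] by auto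
    then have "u \<in> I" using u(1) unfolding I_def by (intro CollectI conjI exI[of _ "k * l"]) simp_all
    then show "x = \<one>\<^bsub>?Z Mod I\<^esub>" using I.r_coset_eq_iff[OF u(1)] u(2) by simp
  qed
  have zim: "(\<lambda>z. I #>\<^bsub>?Z\<^esub> z) ` carrier ?Z = carrier (?Z Mod I)"
    by (simp only: carrier_FactGroup)
  have "fin_gen (?Z Mod I)" by (rule Zq.fin_gen_image[OF Z.spans_imp_fin_gen[OF z0Z] zim])
  then obtain t d0 where d0: "spans (?Z Mod I) (carrier (?Z Mod I)) t d0" "indep (?Z Mod I) t d0"
    using ZI.exists_basis_grp_rank ZI.spans_grp_rank tfZI by blast
  have "\<forall>j. \<exists>z. j < t \<longrightarrow> z \<in> carrier ?Z \<and> d0 j = I #>\<^bsub>?Z\<^esub> z"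
    using spansD(1)[OF d0(1)] zim by blast
  then obtain d where d: "\<forall>j<t. d j \<in> carrier ?Z" "\<And>j. j < t \<Longrightarrow> d0 j = I #>\<^bsub>?Z\<^esub> d j" by metis
  have dd: "spans (?Z Mod I) (carrier (?Z Mod I)) t (\<lambda>j. I #>\<^bsub>?Z\<^esub> d j)"
    "indep (?Z Mod I) t (\<lambda>j. I #>\<^bsub>?Z\<^esub> d j)"
    using d0 spans_cong[of t d0 "\<lambda>j. I #>\<^bsub>?Z\<^esub> d j"] indep_cong[of t d0 "\<lambda>j. I #>\<^bsub>?Z\<^esub> d j"] d(2)
    by metis+
  have hZ: "(\<lambda>z. I #>\<^bsub>?Z\<^esub> z) \<in> hom (?Z\<lparr>carrier := carrier ?Z\<rparr>) (?Z Mod I)"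
    using Zq.homh by simp
  \<comment> \<open>The basis \<open>i\<close> of \<open>I\<close> comes last, so that it falls
    within the final \<open>m\<close> elements of the whole family.\<close>
  define E where "E = append_fun t d i"
  have sE: "spans ?Z (carrier ?Z) (t + r) E" unfolding E_def
    by (rule Z.spans_chain[OF Zq.H.is_group Z.subgroup_self hZ d(1)])
      (simp_all only: zim dd I.quotient_kernel ri)
  have iE: "indep ?Z (t + r) E" unfolding E_def
  proof (rule Z.indep_chain[OF Zq.H.is_group Z.subgroup_self hZ d(1) dd(2) iZ _ ri(2)])
    fix j assume "j < r"
    then show "I #>\<^bsub>?Z\<^esub> i j = \<one>\<^bsub>?Z Mod I\<^esub>" using I.r_coset_eq_iff iI iZ by simp
  qed
  have q: "q = t + r" unfolding q_def by (rule Z.grp_rank_eq[OF sE iE])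
  have EZ: "\<forall>j<q. E j \<in> center G" using spansD(1)[OF sE] q by simp
  have sE': "spans G (center G) q E" "indep G q E"
    using sE iE spans_consistent[OF center_subgroup order_refl] indep_consistent[OF center_subgroup EZ] q
    by simp_all
  define B where "B = append_fun p g E"
  have hG: "(\<lambda>g. center G #> g) \<in> hom (G\<lparr>carrier := carrier G\<rparr>) (G Mod center G)"
    using p.homh by simp
  have sB: "spans G (carrier G) (p + q) B" unfolding B_def
    by (rule spans_chain[OF p.H.is_group subgroup_self hG g(1)])
      (simp_all only: pim e' N.quotient_kernel sE')
  have iB: "indep G (p + q) B" unfolding B_def
  proof (rule indep_chain[OF p.H.is_group subgroup_self hG g(1) e'(2) _ _ sE'(2)])
    fix j assume "j < q"
    then show "center G #> E j = \<one>\<^bsub>G Mod center G\<^esub>"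
      using N.r_coset_eq_iff EZ center_closed by simp
  qed (use EZ center_closed in auto)
  \<comment> \<open>The family is cut at \<open>n\<close>, not at \<open>p\<close>. From
    \<open>p + q = n + m\<close> and \<open>m \<le> q\<close> follows \<open>p \<le> n\<close>, so
    everything from position \<open>n\<close> on belongs to the central part
    \<open>E\<close>.\<close>
  define c where "c j = B (n + j)" for j
  have pq: "p + q = n + m" using nm by (simp add: p_def q_def)
  have mq: "m \<le> q" using m2 by (simp add: q_def)
  have Bac: "append_fun n B c = B" by (auto simp: append_fun_def c_def fun_eq_iff)
  have BG: "\<forall>j<n. B j \<in> carrier G" using spansD(1)[OF sB] pq by auto
  have cZ: "\<forall>j<m. c j \<in> center G"
  proof (intro allI impI)
    fix j assume j: "j < m"
    have "c j = E (n + j - p)" using pq mq by (auto simp: c_def B_def append_fun_def)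
    moreover have "n + j - p < q" using j pq mq by simp
    ultimately show "c j \<in> center G" using EZ by simp
  qed
  have cG: "\<forall>j<m. c j \<in> carrier G" using cZ center_closed by blast
  have "comm G (B j) (B l) \<in> range (\<lambda>y. ordprod G c y m)" if "j < n" "l < n" for j l
  proof -
    have "comm G (B j) (B l) \<in> I" using comm_in_derived BG that DI by blast
    then obtain y where "comm G (B j) (B l) = ordprod ?Z i y r" using spansD(2)[OF ri(1)] by blast
    then have y: "comm G (B j) (B l) = ordprod G i y r"
      using ordprod_consistent[OF center_subgroup] iZ by simp
    \<comment> \<open>The last \<open>r\<close> of the \<open>m\<close> elements \<open>c\<close>
      are the basis of \<open>I\<close>; the \<open>k\<close> preceding ones receive exponent
      0.\<close>
    define k where "k = m - r"
    have mk: "m = k + r" using rm by (simp add: k_def)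
    have ci: "c (k + j) = i j" for j
    proof -
      have "n + (k + j) = p + (t + j)" using pq q mk by simp
      then have "c (k + j) = B (p + (t + j))" by (simp only: c_def)
      then show ?thesis by (simp add: B_def E_def)
    qed
    define x where "x = append_fun k (\<lambda>_. 0) y"
    have "ordprod G c x m = ordprod G c x k \<otimes> ordprod G i y r"
      using ordprod_add_index[of k r c x] cG ci by (simp add: mk x_def)
    also have "ordprod G c x k = \<one>" by (rule ordprod_zero) (simp add: x_def)
    finally have "ordprod G c x m = comm G (B j) (B l)" using y comm_closed[of "B j" "B l"] BG that by simp
    then show ?thesis by (metis rangeI)
  qed
  then have "central_basis G n m B c"
    unfolding central_basis_def Bac using BG cZ sB iB pq by simp
  then show ?thesis by blast
qed

end

section \<open>Words and presented groups\<close>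

lemma words_Nil [simp]: "[] \<in> words S"
  and words_Cons [simp]: "p # w \<in> words S \<longleftrightarrow> fst p \<in> S \<and> w \<in> words S"
  and words_append [simp]: "u @ v \<in> words S \<longleftrightarrow> u \<in> words S \<and> v \<in> words S"
  by (cases p; auto simp: words_def)+

definition inv_word :: "'g word \<Rightarrow> 'g word" where
  "inv_word w = rev (map (\<lambda>(x, b). (x, \<not> b)) w)"

lemma inv_word_simps [simp]:
  "inv_word [] = []" "inv_word ((x, b) # w) = inv_word w @ [(x, \<not> b)]"
  by (simp_all add: inv_word_def)

lemma inv_word_words [simp]: "w \<in> words S \<Longrightarrow> inv_word w \<in> words S"
  by (induction w) (auto simp: inv_word_def)

lemma word_equiv_refl [simp]: "word_equiv S R w w"
  by (simp add: word_equiv_def)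

lemma word_equiv_sym: "word_equiv S R u v \<Longrightarrow> word_equiv S R v u"
proof -
  have "symp (sup (word_step S R) (word_step S R)\<inverse>\<inverse>)" by (auto simp: symp_def)
  then show "word_equiv S R u v \<Longrightarrow> word_equiv S R v u"
    unfolding word_equiv_def using symp_rtranclp sympD by metis
qed

lemma word_equiv_trans: "word_equiv S R u v \<Longrightarrow> word_equiv S R v w \<Longrightarrow> word_equiv S R u w"
  by (simp add: word_equiv_def)

lemma word_step_imp_equiv: "word_step S R u v \<Longrightarrow> word_equiv S R u v"
  unfolding word_equiv_def by (rule r_into_rtranclp) simp

lemma word_equiv_induct [consumes 1, case_names refl step sym_step]:
  assumes "word_equiv S R u v" "P u"
    "\<And>x y. P x \<Longrightarrow> word_step S R x y \<Longrightarrow> P y"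
    "\<And>x y. P x \<Longrightarrow> word_step S R y x \<Longrightarrow> P y"
  shows "P v"
  using assms(1)[unfolded word_equiv_def]
proof (induction rule: rtranclp_induct)
  case (step y z)
  then have "word_step S R y z \<or> word_step S R z y" by simp
  then show ?case using assms(3,4) step.IH by blast
qed (rule assms(2))

lemma word_step_append:
  assumes "word_step S R u v"
  shows "word_step S R (p @ u @ q) (p @ v @ q)"
  using assms
proof cases
  case (cancel x u' b v')
  then show ?thesis using word_step.cancel[of x S R "p @ u'" b "v' @ q"] by simp
next
  case (rel l r u' v')
  then show ?thesis using word_step.rel[of l r R S "p @ u'" "v' @ q"] by simp
qed

lemma word_equiv_append_both:
  assumes "word_equiv S R u v"
  shows "word_equiv S R (p @ u @ q) (p @ v @ q)"
  using assms
proof (induction rule: word_equiv_induct)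
  case (step x y)
  then show ?case using word_equiv_trans word_step_imp_equiv word_step_append by metis
next
  case (sym_step x y)
  then show ?case
    using word_equiv_trans word_step_imp_equiv word_step_append word_equiv_sym by metis
qed simp

lemma word_equiv_append:
  assumes "word_equiv S R u u'" "word_equiv S R v v'"
  shows "word_equiv S R (u @ v) (u' @ v')"
  using word_equiv_append_both[OF assms(1), of "[]" v] word_equiv_append_both[OF assms(2), of u' "[]"]
    word_equiv_trans by fastforce

lemma word_equiv_inv_left:
  "w \<in> words S \<Longrightarrow> word_equiv S R (inv_word w @ w) []"
proof (induction w)
  case (Cons p w)
  obtain x b where p: "p = (x, b)" by (cases p)
  have "word_step S R (inv_word w @ [(x, \<not> b), (x, \<not> \<not> b)] @ w) (inv_word w @ w)"
    by (rule word_step.cancel) (use Cons p in simp)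
  then have "word_equiv S R (inv_word (p # w) @ p # w) (inv_word w @ w)"
    using word_step_imp_equiv by (fastforce simp: p)
  then show ?case using Cons word_equiv_trans by (metis words_Cons)
qed simp

lemma word_equiv_inv_right:
  "w \<in> words S \<Longrightarrow> word_equiv S R (w @ inv_word w) []"
proof (induction w)
  case (Cons p w)
  obtain x b where p: "p = (x, b)" by (cases p)
  have 1: "word_equiv S R ([(x, b)] @ (w @ inv_word w) @ [(x, \<not> b)]) ([(x, b)] @ [] @ [(x, \<not> b)])"
    by (rule word_equiv_append_both) (use Cons in simp)
  have "word_step S R ([] @ [(x, b), (x, \<not> b)] @ []) ([] @ [])"
    by (rule word_step.cancel) (use Cons p in simp)
  then have "word_equiv S R ([(x, b)] @ [] @ [(x, \<not> b)]) []"
    using word_step_imp_equiv by fastforce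
  with 1 have "word_equiv S R ([(x, b)] @ (w @ inv_word w) @ [(x, \<not> b)]) []"
    by (rule word_equiv_trans)
  then show ?case by (simp add: p)
qed simp

section \<open>Evaluation of words\<close>

context group
begin

lemma eval_word_closed [simp]:
  "f ` S \<subseteq> carrier G \<Longrightarrow> w \<in> words S \<Longrightarrow> eval_word G f w \<in> carrier G"
  by (induction w) (auto simp: image_subset_iff)

lemma eval_word_append:
  assumes f: "f ` S \<subseteq> carrier G" and u: "u \<in> words S" and v: "v \<in> words S"
  shows "eval_word G f (u @ v) = eval_word G f u \<otimes> eval_word G f v"
  using u
proof (induction u)
  case Nil
  then show ?case using f v by simp
next
  case (Cons p u)
  obtain x b where p: "p = (x, b)" by (cases p)
  have "f x \<in> carrier G" "eval_word G f u \<in> carrier G" "eval_word G f v \<in> carrier G"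
    using f v Cons.prems p by auto
  then show ?case using Cons p by (simp add: m_assoc)
qed

lemma eval_word_equiv:
  assumes f: "f ` S \<subseteq> carrier G" and R: "R \<subseteq> words S \<times> words S"
    and hold: "\<forall>(l, r)\<in>R. eval_word G f l = eval_word G f r"
    and eq: "word_equiv S R u v" and u: "u \<in> words S"
  shows "eval_word G f u = eval_word G f v"
proof -
  \<comment> \<open>The contexts in \<open>word_step\<close> are arbitrary words, so membership in
    \<open>words S\<close> has to be carried along in both directions; outside it \<open>f\<close>
    need not take values in the carrier.\<close>
  have step: "(x \<in> words S \<longleftrightarrow> y \<in> words S) \<and>
    (x \<in> words S \<longrightarrow> eval_word G f x = eval_word G f y)" if "word_step S R x y" for x y
    using that
  proof cases
    case (cancel z u b v)
    have "f z \<in> carrier G" using f cancel by auto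
    then have "eval_word G f [(z, b), (z, \<not> b)] = \<one>" by simp
    moreover have "[(z, b), (z, \<not> b)] \<in> words S" using cancel by simp
    ultimately have "eval_word G f (u @ [(z, b), (z, \<not> b)] @ v) = eval_word G f (u @ v)"
      if "u \<in> words S" "v \<in> words S"
      using that f by (simp add: eval_word_append del: eval_word.simps append.simps)
    then show ?thesis using cancel by auto
  next
    case (rel l r u v)
    have lr: "l \<in> words S" "r \<in> words S" "eval_word G f l = eval_word G f r"
      using rel R hold by auto
    then have "eval_word G f (u @ l @ v) = eval_word G f (u @ r @ v)"
      if "u \<in> words S" "v \<in> words S"
      using that f by (simp add: eval_word_append)
    then show ?thesis using rel lr by auto
  qed
  have "v \<in> words S \<and> eval_word G f u = eval_word G f v"
    using eq by (induction rule: word_equiv_induct) (use u step in metis)+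
  then show ?thesis by simp
qed

text \<open>With no relations \<open>word_equiv\<close> is free reduction, which every group
  respects; so the cancellation of \<open>inv_word w @ w\<close> can be evaluated in
  \<open>G\<close>.\<close>

lemma eval_inv_word:
  assumes f: "f ` S \<subseteq> carrier G" and w: "w \<in> words S"
  shows "eval_word G f (inv_word w) = inv (eval_word G f w)"
proof -
  have "eval_word G f (inv_word w @ w) = \<one>"
    using eval_word_equiv[OF f, of "{}"] word_equiv_inv_left[OF w, of "{}"] w by fastforce
  then show ?thesis using eval_word_append[OF f, of "inv_word w" w] w f
    by (simp add: inv_equality)
qed

lemma eval_comm_word:
  "f x \<in> carrier G \<Longrightarrow> f y \<in> carrier G \<Longrightarrow> eval_word G f (comm_word x y) = comm G (f x) (f y)"
  by (simp add: comm_word_def comm_def m_assoc)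

lemma eval_pow_word:
  assumes x: "f x \<in> carrier G"
  shows "eval_word G f (pow_word x k) = f x [^] k"
proof -
  have *: "eval_word G f (replicate j (x, b)) = (if b then f x else inv (f x)) [^] j" for j b
    using x by (induction j) (simp_all add: group_commutes_pow)
  show ?thesis
  proof (cases k rule: int_cases)
    case (nonneg j)
    then show ?thesis by (simp add: pow_word_def * int_pow_int)
  next
    case (neg j)
    then have "k < 0" "nat \<bar>k\<bar> = Suc j" by simp_all
    then have pw: "pow_word x k = replicate (Suc j) (x, False)" by (simp add: pow_word_def)
    have "eval_word G f (pow_word x k) = inv (f x) [^] Suc j"
      using *[of "Suc j" False] by (simp only: pw if_False)
    also have "\<dots> = f x [^] (- int (Suc j))"
      using x nat_pow_inv[of "f x" "Suc j"] int_pow_neg_int[of "f x" "Suc j"] by presburger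
    finally show ?thesis using neg by simp
  qed
qed

end

section \<open>Ordered words and the presented group\<close>

definition ord_word :: "(nat \<Rightarrow> 'g) \<Rightarrow> (nat \<Rightarrow> int) \<Rightarrow> nat \<Rightarrow> 'g word" where
  "ord_word b x k = concat (map (\<lambda>i. pow_word (b i) (x i)) [0..<k])"

lemma ord_word_simps [simp]:
  "ord_word b x 0 = []" "ord_word b x (Suc k) = ord_word b x k @ pow_word (b k) (x k)"
  by (simp_all add: ord_word_def)

lemma pow_word_words [simp]: "x \<in> S \<Longrightarrow> pow_word x k \<in> words S"
  by (auto simp: pow_word_def words_def)

lemma ord_word_words [simp]: "\<forall>i<k. b i \<in> S \<Longrightarrow> ord_word b x k \<in> words S"
  by (induction k) auto

lemma ord_word_zero: "\<forall>i<k. x i = 0 \<Longrightarrow> ord_word b x k = []"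
  by (induction k) (auto simp: pow_word_def)

lemma cprod_word_eq: "cprod_word m lam i j = ord_word Inr (lam i j) m"
  by (simp add: cprod_word_def ord_word_def)

lemma (in group) eval_ord_word:
  assumes f: "f ` S \<subseteq> carrier G" and b: "\<forall>i<k. b i \<in> S"
  shows "eval_word G f (ord_word b x k) = ordprod G (\<lambda>i. f (b i)) x k"
  using b
proof (induction k)
  case (Suc k)
  then have "f (b k) \<in> carrier G" using f by auto
  then show ?case using Suc f by (simp add: eval_word_append[OF f] eval_pow_word)
qed simp

definition word_class :: "'g set \<Rightarrow> ('g word \<times> 'g word) set \<Rightarrow> 'g word \<Rightarrow> 'g word set" where
  "word_class S R w = {v. word_equiv S R w v}"

text \<open>Multiplication concatenates arbitrarily chosen representatives; since
  \<open>word_equiv\<close> is a congruence, the choice has no effect on the resulting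
  class.\<close>

definition presented_group :: "'g set \<Rightarrow> ('g word \<times> 'g word) set \<Rightarrow> 'g word set monoid" where
  "presented_group S R =
     \<lparr>carrier = word_class S R ` words S,
      monoid.mult = (\<lambda>A B. word_class S R ((SOME u. u \<in> A) @ (SOME v. v \<in> B))),
      one = word_class S R []\<rparr>"

lemma word_class_eq_iff: "word_class S R u = word_class S R v \<longleftrightarrow> word_equiv S R u v"
  unfolding word_class_def using word_equiv_refl word_equiv_sym word_equiv_trans by blast

lemma presented_group_mult:
  "word_class S R u \<otimes>\<^bsub>presented_group S R\<^esub> word_class S R v = word_class S R (u @ v)"
proof -
  have "word_equiv S R w (SOME v. v \<in> word_class S R w)" for w
    using someI[of "\<lambda>v. v \<in> word_class S R w" w] by (simp add: word_class_def)
  then have "word_equiv S R (u @ v) ((SOME w. w \<in> word_class S R u) @ (SOME w. w \<in> word_class S R v))"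
    by (intro word_equiv_append)
  then show ?thesis
    by (simp add: presented_group_def word_class_eq_iff word_equiv_sym)
qed

lemma presented_group_carrier: "carrier (presented_group S R) = word_class S R ` words S"
  and presented_group_one: "\<one>\<^bsub>presented_group S R\<^esub> = word_class S R []"
  by (simp_all add: presented_group_def)

lemma group_presented_group: "group (presented_group S R)"
proof (rule groupI)
  fix x assume "x \<in> carrier (presented_group S R)"
  then obtain w where w: "w \<in> words S" "x = word_class S R w"
    by (auto simp: presented_group_carrier)
  have "word_class S R (inv_word w) \<otimes>\<^bsub>presented_group S R\<^esub> x = \<one>\<^bsub>presented_group S R\<^esub>"
    by (simp add: w presented_group_mult presented_group_one word_class_eq_iff word_equiv_inv_left)
  then show "\<exists>y\<in>carrier (presented_group S R). y \<otimes>\<^bsub>presented_group S R\<^esub> x = \<one>\<^bsub>presented_group S R\<^esub>"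
    using w by (auto simp: presented_group_carrier intro!: bexI[of _ "inv_word w"])
qed (auto simp: presented_group_carrier presented_group_one presented_group_mult)

text \<open>Evaluation at the classes of the generators is the canonical projection, so equality of
  values in the presented group is exactly \<open>word_equiv\<close>.\<close>

lemma presented_group_eval:
  assumes "w \<in> words S"
  shows "eval_word (presented_group S R) (\<lambda>x. word_class S R [(x, True)]) w = word_class S R w"
  using assms
proof (induction w)
  case (Cons p w)
  interpret P: group "presented_group S R" by (rule group_presented_group)
  obtain x b where p: "p = (x, b)" by (cases p)
  then have x: "x \<in> S" using Cons.prems by simp
  have "word_step S R ([] @ [(x, False), (x, \<not> False)] @ []) ([] @ [])"
    by (rule word_step.cancel[OF x])
  then have "word_equiv S R [(x, False), (x, True)] []"
    using word_step_imp_equiv by fastforce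
  then have "inv\<^bsub>presented_group S R\<^esub> (word_class S R [(x, True)]) = word_class S R [(x, False)]"
    using x by (intro P.inv_equality)
      (simp_all add: presented_group_mult presented_group_one presented_group_carrier word_class_eq_iff imageI)
  then show ?case using Cons p by (cases b) (simp_all add: presented_group_mult)
qed (simp add: presented_group_one)

section \<open>The relations of a nilpotent presentation\<close>

lemma rels_words: "rels n m lam \<subseteq> words (gens n m) \<times> words (gens n m)"
proof -
  have "ord_word Inr x m \<in> words (gens n m)" for x
    by (rule ord_word_words) (simp add: gens_def)
  then show ?thesis
    by (auto simp: rels_def comm_word_def gens_def cprod_word_eq)
qed

lemma (in group) rels_hold_iff:
  assumes f: "f ` gens n m \<subseteq> carrier G"
  shows "(\<forall>(l, r)\<in>rels n m lam. eval_word G f l = eval_word G f r) \<longleftrightarrow>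
    (\<forall>j<n. \<forall>i<j. comm G (f (Inl i)) (f (Inl j)) = ordprod G (\<lambda>t. f (Inr t)) (lam i j) m) \<and>
    (\<forall>i<n. \<forall>t<m. comm G (f (Inl i)) (f (Inr t)) = \<one>) \<and>
    (\<forall>s<m. \<forall>t<m. comm G (f (Inr s)) (f (Inr t)) = \<one>)"
proof -
  have a: "f (Inl i) \<in> carrier G" if "i < n" for i using f that by (auto simp: gens_def)
  have c: "f (Inr t) \<in> carrier G" if "t < m" for t using f that by (auto simp: gens_def)
  have o: "eval_word G f (ord_word Inr x m) = ordprod G (\<lambda>t. f (Inr t)) x m" for x
    by (rule eval_ord_word[OF f]) (simp add: gens_def)
  have "(\<forall>(l, r)\<in>rels n m lam. eval_word G f l = eval_word G f r) \<longleftrightarrow>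
    (\<forall>j<n. \<forall>i<j. eval_word G f (comm_word (Inl i) (Inl j)) = eval_word G f (cprod_word m lam i j)) \<and>
    (\<forall>i<n. \<forall>t<m. eval_word G f (comm_word (Inl i) (Inr t)) = eval_word G f []) \<and>
    (\<forall>s<m. \<forall>t<m. eval_word G f (comm_word (Inr s) (Inr t)) = eval_word G f [])"
    unfolding rels_def by blast
  also have "(\<forall>j<n. \<forall>i<j. eval_word G f (comm_word (Inl i) (Inl j)) = eval_word G f (cprod_word m lam i j))
    \<longleftrightarrow> (\<forall>j<n. \<forall>i<j. comm G (f (Inl i)) (f (Inl j)) = ordprod G (\<lambda>t. f (Inr t)) (lam i j) m)"
    by (intro all_cong) (simp add: cprod_word_eq o eval_comm_word a)
  also have "(\<forall>i<n. \<forall>t<m. eval_word G f (comm_word (Inl i) (Inr t)) = eval_word G f []) \<longleftrightarrow>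
    (\<forall>i<n. \<forall>t<m. comm G (f (Inl i)) (f (Inr t)) = \<one>)"
    by (intro all_cong) (simp add: eval_comm_word a c)
  also have "(\<forall>s<m. \<forall>t<m. eval_word G f (comm_word (Inr s) (Inr t)) = eval_word G f []) \<longleftrightarrow>
    (\<forall>s<m. \<forall>t<m. comm G (f (Inr s)) (f (Inr t)) = \<one>)"
    by (intro all_cong) (simp add: eval_comm_word c)
  finally show ?thesis .
qed

text \<open>Besides \<open>G\<close>, this is applied to the presented group itself, where it says
  that every word is equivalent to an ordered one.\<close>

lemma (in group) spans_if_rels_hold:
  assumes f: "f ` gens n m \<subseteq> carrier G"
    and hold: "\<forall>(l, r)\<in>rels n m lam. eval_word G f l = eval_word G f r"
    and surj: "carrier G \<subseteq> eval_word G f ` words (gens n m)"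
  shows "\<forall>t<m. f (Inr t) \<in> center G"
    "spans G (carrier G) (n + m) (append_fun n (\<lambda>i. f (Inl i)) (\<lambda>t. f (Inr t)))"
proof -
  let ?a = "\<lambda>i. f (Inl i)" and ?c = "\<lambda>t. f (Inr t)"
  let ?S = "?a ` {..<n} \<union> ?c ` {..<m}"
  have a: "\<forall>i<n. ?a i \<in> carrier G" and c: "\<forall>t<m. ?c t \<in> carrier G"
    using f by (auto simp: gens_def)
  then have S: "?S \<subseteq> carrier G" by auto
  have "f ` gens n m \<subseteq> generate G ?S"
    by (auto simp: gens_def intro!: generate.incl)
  then have "eval_word G f w \<in> generate G ?S" if "w \<in> words (gens n m)" for w
    using that
  proof (induction w)
    case (Cons p w)
    obtain x b where p: "p = (x, b)" by (cases p)
    have "f x \<in> generate G ?S" "eval_word G f w \<in> generate G ?S" using Cons p by auto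
    then show ?case using generate_m_inv_closed[OF S] p by (auto intro: generate.eng)
  qed (simp add: generate.one)
  then have gen: "generate G ?S = carrier G" using surj generate_incl[OF S] by blast
  note r = hold[unfolded rels_hold_iff[OF f]]
  have comm1: "y \<otimes> x = x \<otimes> y" if "comm G x y = \<one>" "x \<in> carrier G" "y \<in> carrier G" for x y
    using that comm_eq_iff[of x y \<one>] by simp
  have ac: "\<forall>i<n. \<forall>t<m. ?c t \<otimes> ?a i = ?a i \<otimes> ?c t" "\<forall>s<m. \<forall>t<m. ?c t \<otimes> ?c s = ?c s \<otimes> ?c t"
  proof -
    show "\<forall>i<n. \<forall>t<m. ?c t \<otimes> ?a i = ?a i \<otimes> ?c t"
    proof (intro allI impI)
      fix i t assume "i < n" "t < m"
      then show "?c t \<otimes> ?a i = ?a i \<otimes> ?c t" using comm1[of "?a i" "?c t"] r a c by simp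
    qed
    show "\<forall>s<m. \<forall>t<m. ?c t \<otimes> ?c s = ?c s \<otimes> ?c t"
    proof (intro allI impI)
      fix s t assume "s < m" "t < m"
      then show "?c t \<otimes> ?c s = ?c s \<otimes> ?c t" using comm1[of "?c s" "?c t"] r c by simp
    qed
  qed
  have aa: "\<forall>j<n. \<forall>i<j. comm G (?a i) (?a j) \<in> range (\<lambda>y. ordprod G ?c y m)"
    using r by blast
  note col = collect[OF a c gen ac aa]
  show "\<forall>t<m. f (Inr t) \<in> center G" "spans G (carrier G) (n + m) (append_fun n ?a ?c)"
    using col(1,6) by blast+
qed

section \<open>A central extension satisfying the relations\<close>

text \<open>A bilinear map from pairs of exponent vectors of the \<open>a\<close>'s to exponent
  vectors of the \<open>c\<close>'s. Multiplying ordered forms moves each later \<open>a j\<close>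
  of the left factor past each earlier \<open>a i\<close> of the right one, and
  \<open>a j \<otimes> a i\<close> equals \<open>a i \<otimes> a j\<close> times the inverse of
  their commutator, whence the minus sign.\<close>

definition cocycle :: "nat \<Rightarrow> nat \<Rightarrow> (nat \<Rightarrow> nat \<Rightarrow> nat \<Rightarrow> int) \<Rightarrow> (nat \<Rightarrow> int) \<Rightarrow> (nat \<Rightarrow> int) \<Rightarrow> nat \<Rightarrow> int" where
  "cocycle n m lam x y t = (if t < m then \<Sum>j<n. x j * (\<Sum>i<j. - lam i j t * y i) else 0)"

text \<open>The central extension of the free abelian group on the \<open>a\<close>'s by the free abelian group on the
  \<open>c\<close>'s in which the relations hold by design: collecting \<open>a\<^sub>j a\<^sub>i\<close> with \<open>i < j\<close> costs
  \<open>- lam i j\<close>.\<close>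

definition extension_group :: "nat \<Rightarrow> nat \<Rightarrow> (nat \<Rightarrow> nat \<Rightarrow> nat \<Rightarrow> int) \<Rightarrow> ((nat \<Rightarrow> int) \<times> (nat \<Rightarrow> int)) monoid" where
  "extension_group n m lam =
     \<lparr>carrier = UNIV,
      monoid.mult = (\<lambda>(x, y) (x', y'). (\<lambda>i. x i + x' i, \<lambda>t. y t + y' t + cocycle n m lam x x' t)),
      one = (\<lambda>_. 0, \<lambda>_. 0)\<rparr>"

definition scaled_unit :: "nat \<Rightarrow> int \<Rightarrow> nat \<Rightarrow> int" where
  "scaled_unit p z i = (if i = p then z else 0)"

lemma cocycle_add_left:
  "cocycle n m lam (\<lambda>i. x i + x' i) y t = cocycle n m lam x y t + cocycle n m lam x' y t"
  by (simp add: cocycle_def distrib_right sum.distrib)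

lemma cocycle_add_right:
  "cocycle n m lam x (\<lambda>i. y i + y' i) t = cocycle n m lam x y t + cocycle n m lam x y' t"
  by (cases "t < m") (simp_all only: cocycle_def distrib_left sum.distrib if_True if_False add_0)

lemma cocycle_zero [simp]:
  "cocycle n m lam (\<lambda>_. 0) y = (\<lambda>_. 0)" "cocycle n m lam x (\<lambda>_. 0) = (\<lambda>_. 0)"
  by (auto simp: cocycle_def)

lemma cocycle_uminus_left: "cocycle n m lam (\<lambda>i. - x i) y t = - cocycle n m lam x y t"
  using cocycle_add_left[of n m lam x "\<lambda>i. - x i" y t] by simp

lemma cocycle_unit_right:
  "cocycle n m lam x (scaled_unit q w) t = (if t < m then \<Sum>j<n. x j * (if q < j then - lam q j t * w else 0) else 0)"
proof -
  have "(\<Sum>i<j. - lam i j t * scaled_unit q w i) = (if q < j then - lam q j t * w else 0)" for j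
  proof -
    have "(\<Sum>i<j. - lam i j t * scaled_unit q w i) = (\<Sum>i<j. if i = q then - lam q j t * w else 0)"
      by (rule sum.cong) (auto simp: scaled_unit_def)
    then show ?thesis by simp
  qed
  then show ?thesis by (simp only: cocycle_def)
qed

lemma cocycle_units:
  assumes "p < n"
  shows "cocycle n m lam (scaled_unit p z) (scaled_unit q w) t =
    (if t < m \<and> q < p then - lam q p t * z * w else 0)"
proof -
  have "(\<Sum>j<n. scaled_unit p z j * (if q < j then - lam q j t * w else 0)) =
    (\<Sum>j<n. if j = p then (if q < p then - lam q p t * z * w else 0) else 0)"
    by (rule sum.cong) (auto simp: scaled_unit_def)
  then show ?thesis using assms by (simp add: cocycle_unit_right)
qed

lemma extension_group_simps [simp]:
  "carrier (extension_group n m lam) = UNIV"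
  "\<one>\<^bsub>extension_group n m lam\<^esub> = (\<lambda>_. 0, \<lambda>_. 0)"
  "(x, y) \<otimes>\<^bsub>extension_group n m lam\<^esub> (x', y') =
    (\<lambda>i. x i + x' i, \<lambda>t. y t + y' t + cocycle n m lam x x' t)"
  by (simp_all add: extension_group_def)

text \<open>Bilinearity of \<open>cocycle\<close> is exactly what makes the product associative; the
  term \<open>cocycle n m lam x x\<close> in the inverse offsets the correction produced by
  \<open>- x\<close> and \<open>x\<close>.\<close>

lemma group_extension_group: "group (extension_group n m lam)"
proof (rule groupI)
  fix g :: "(nat \<Rightarrow> int) \<times> (nat \<Rightarrow> int)"
  obtain x y where g: "g = (x, y)" by (cases g)
  have "(\<lambda>i. - x i, \<lambda>t. - y t + cocycle n m lam x x t) \<otimes>\<^bsub>extension_group n m lam\<^esub> g =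
    \<one>\<^bsub>extension_group n m lam\<^esub>"
    by (simp add: g cocycle_uminus_left)
  then show "\<exists>h\<in>carrier (extension_group n m lam). h \<otimes>\<^bsub>extension_group n m lam\<^esub> g = \<one>\<^bsub>extension_group n m lam\<^esub>"
    by (intro bexI) auto
qed (auto simp: cocycle_add_left cocycle_add_right algebra_simps)

text \<open>The cocycle vanishes on two multiples of the same unit vector, so these multiples form a
  homomorphic image of the integers.\<close>

lemma extension_group_pow:
  fixes z :: int
  assumes "p < n"
  shows "(scaled_unit p 1, \<lambda>_. 0) [^]\<^bsub>extension_group n m lam\<^esub> z = (scaled_unit p z, \<lambda>_. 0)"
proof -
  let ?h = "\<lambda>z. (scaled_unit p z, \<lambda>_. 0 :: int)"
  have "?h \<in> hom integer_group (extension_group n m lam)"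
    using assms by (intro homI) (auto simp: cocycle_units scaled_unit_def fun_eq_iff)
  from hom_int_pow[OF this, of 1 z] show ?thesis by (simp add: group_extension_group)
qed

lemma extension_group_central_pow:
  fixes z :: int
  shows "(\<lambda>_. 0, scaled_unit p 1) [^]\<^bsub>extension_group n m lam\<^esub> z = (\<lambda>_. 0, scaled_unit p z)"
proof -
  let ?h = "\<lambda>z. (\<lambda>_. 0 :: int, scaled_unit p z)"
  have "?h \<in> hom integer_group (extension_group n m lam)"
    by (intro homI) (auto simp: scaled_unit_def fun_eq_iff)
  from hom_int_pow[OF this, of 1 z] show ?thesis by (simp add: group_extension_group)
qed

text \<open>In an ordered product each new index exceeds all earlier ones, so nothing has to be
  moved and every cocycle term is zero.\<close>

lemma extension_group_ordprod:
  assumes "k \<le> n"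
  shows "ordprod (extension_group n m lam) (\<lambda>i. (scaled_unit i 1, \<lambda>_. 0)) x k =
    (\<lambda>i. if i < k then x i else 0, \<lambda>_. 0)"
  using assms
proof (induction k)
  case (Suc k)
  have "cocycle n m lam (\<lambda>i. if i < k then x i else 0) (scaled_unit k (x k)) t = 0" for t
    unfolding cocycle_unit_right by (auto intro!: sum.neutral)
  then show ?case using Suc
    by (simp add: extension_group_pow) (auto simp: scaled_unit_def fun_eq_iff less_Suc_eq)
qed simp

lemma extension_group_central_ordprod:
  "ordprod (extension_group n m lam) (\<lambda>t. (\<lambda>_. 0, scaled_unit t 1)) y k =
    (\<lambda>_. 0, \<lambda>t. if t < k then y t else 0)"
proof (induction k)
  case (Suc k)
  then show ?case
    by (simp add: extension_group_central_pow) (auto simp: scaled_unit_def fun_eq_iff less_Suc_eq)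
qed simp

section \<open>Images of the generators in the extension\<close>

definition extension_gen :: "nat + nat \<Rightarrow> (nat \<Rightarrow> int) \<times> (nat \<Rightarrow> int)" where
  "extension_gen s = (case s of Inl i \<Rightarrow> (scaled_unit i 1, \<lambda>_. 0) | Inr t \<Rightarrow> (\<lambda>_. 0, scaled_unit t 1))"

lemma extension_gen_simps [simp]:
  "extension_gen (Inl i) = (scaled_unit i 1, \<lambda>_. 0)"
  "extension_gen (Inr t) = (\<lambda>_. 0, scaled_unit t 1)"
  by (simp_all add: extension_gen_def)

text \<open>Rewritten as equations between products, the relation for \<open>i < j\<close> compares
  \<open>a i \<otimes> a j\<close>, which has no correction, with \<open>a j \<otimes> a i\<close>
  times powers of the \<open>c\<close>'s, where the correction \<open>- lam i j\<close> cancels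
  these powers.\<close>

lemma extension_group_rels:
  "\<forall>(l, r)\<in>rels n m lam. eval_word (extension_group n m lam) extension_gen l =
    eval_word (extension_group n m lam) extension_gen r"
proof -
  interpret H: group "extension_group n m lam" by (rule group_extension_group)
  have "extension_gen ` gens n m \<subseteq> carrier (extension_group n m lam)" by simp
  then show ?thesis
    by (subst H.rels_hold_iff)
      (auto simp: H.comm_eq_iff extension_group_central_ordprod cocycle_units fun_eq_iff)
qed

text \<open>The extension serves as a test group: it satisfies the relations, and an ordered product
  of its generators displays its exponents as coordinates.\<close>

lemma extension_group_indep:
  "indep (extension_group n m lam) (n + m)
    (append_fun n (\<lambda>i. extension_gen (Inl i)) (\<lambda>t. extension_gen (Inr t)))"
  unfolding indep_def
proof (intro allI impI)
  interpret H: group "extension_group n m lam" by (rule group_extension_group)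
  fix x i assume "ordprod (extension_group n m lam)
      (append_fun n (\<lambda>i. extension_gen (Inl i)) (\<lambda>t. extension_gen (Inr t))) x (n + m) =
    \<one>\<^bsub>extension_group n m lam\<^esub>" and i: "i < n + m"
  then have 1: "(\<lambda>i. if i < n then x i else 0) = (\<lambda>_. 0)"
    and 2: "(\<lambda>t. if t < m then x (n + t) else 0) = (\<lambda>_. 0)"
    by (auto simp: H.ordprod_append_split extension_group_ordprod extension_group_central_ordprod)
  show "x i = 0"
  proof (cases "i < n")
    case True
    then show ?thesis using fun_cong[OF 1, of i] by simp
  next
    case False
    then have "n + (i - n) = i" "i - n < m" using i by simp_all
    then show ?thesis using fun_cong[OF 2, of "i - n"] by simp
  qed
qed

section \<open>Presentations and central bases\<close>

definition gen_seq :: "nat \<Rightarrow> nat \<Rightarrow> nat + nat" where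
  "gen_seq n = append_fun n Inl Inr"

lemma gen_seq_gens: "\<forall>i<n + m. gen_seq n i \<in> gens n m"
  by (auto simp: gen_seq_def append_fun_def gens_def)

lemma (in group) eval_normal_word:
  assumes f: "f ` gens n m \<subseteq> carrier G"
  shows "eval_word G f (ord_word (gen_seq n) x (n + m)) =
    ordprod G (append_fun n (\<lambda>i. f (Inl i)) (\<lambda>t. f (Inr t))) x (n + m)"
proof -
  have "(\<lambda>i. f (gen_seq n i)) = append_fun n (\<lambda>i. f (Inl i)) (\<lambda>t. f (Inr t))"
    by (auto simp: gen_seq_def append_fun_def fun_eq_iff)
  then show ?thesis using eval_ord_word[OF f gen_seq_gens] by simp
qed

lemma (in group) presentation_imp_central_basis:
  assumes pr: "is_presentation G (gens n m) f (rels n m lam)"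
  shows "central_basis G n m (\<lambda>i. f (Inl i)) (\<lambda>t. f (Inr t))"
proof -
  have f: "f ` gens n m \<subseteq> carrier G"
    and surj: "eval_word G f ` words (gens n m) = carrier G"
    and triv: "\<And>w. w \<in> words (gens n m) \<Longrightarrow>
      eval_word G f w = \<one> \<longleftrightarrow> word_equiv (gens n m) (rels n m lam) w []"
    using pr by (auto simp: is_presentation_def)
  \<comment> \<open>\<open>is_presentation\<close> speaks only of words with trivial value, so a
    relation is turned into the word \<open>l @ inv_word r\<close>.\<close>
  have hold: "\<forall>(l, r)\<in>rels n m lam. eval_word G f l = eval_word G f r"
  proof (rule ballI, rule prod.case_eq_if[THEN iffD2])
    fix p assume p: "p \<in> rels n m lam"
    obtain l r where lr: "p = (l, r)" by (cases p)
    have w: "l \<in> words (gens n m)" "r \<in> words (gens n m)" using p lr rels_words by auto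
    have "word_step (gens n m) (rels n m lam) ([] @ l @ inv_word r) ([] @ r @ inv_word r)"
      by (rule word_step.rel) (use p lr in simp)
    then have "word_equiv (gens n m) (rels n m lam) (l @ inv_word r) (r @ inv_word r)"
      using word_step_imp_equiv by fastforce
    then have "word_equiv (gens n m) (rels n m lam) (l @ inv_word r) []"
      using word_equiv_inv_right[OF w(2)] word_equiv_trans by blast
    then have "eval_word G f l \<otimes> inv (eval_word G f r) = \<one>"
      using triv[of "l @ inv_word r"] w f by (simp add: eval_word_append eval_inv_word)
    then have "eval_word G f l = eval_word G f r"
      using w f by (simp add: inv_solve_right[symmetric] eq_commute)
    then show "eval_word G f (fst p) = eval_word G f (snd p)" by (simp add: lr)
  qed
  note sp = spans_if_rels_hold[OF f hold]
  \<comment> \<open>An ordered word with trivial value in \<open>G\<close> is equivalent to the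
    empty word, hence also trivial in the extension, where its exponents can be read off as
    zero.\<close>
  have "indep G (n + m) (append_fun n (\<lambda>i. f (Inl i)) (\<lambda>t. f (Inr t)))"
    unfolding indep_def
  proof (rule allI, rule impI)
    interpret H: group "extension_group n m lam" by (rule group_extension_group)
    fix x
    let ?w = "ord_word (gen_seq n) x (n + m)"
    assume "ordprod G (append_fun n (\<lambda>i. f (Inl i)) (\<lambda>t. f (Inr t))) x (n + m) = \<one>"
    then have "eval_word G f ?w = \<one>" using eval_normal_word[OF f] by simp
    moreover have w: "?w \<in> words (gens n m)" by (rule ord_word_words[OF gen_seq_gens])
    ultimately have "word_equiv (gens n m) (rels n m lam) ?w []" using triv by blast
    then have "eval_word (extension_group n m lam) extension_gen ?w =
        eval_word (extension_group n m lam) extension_gen []"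
      by (intro H.eval_word_equiv[OF _ rels_words extension_group_rels _ w]) simp
    then show "\<forall>i<n + m. x i = 0"
      using extension_group_indep[of n m lam] H.eval_normal_word[of extension_gen n m x]
      unfolding indep_def by simp
  qed
  then show ?thesis
    unfolding central_basis_def
    using sp surj hold[unfolded rels_hold_iff[OF f]] f by (auto simp: gens_def)
qed

lemma (in group) central_basis_imp_presentation:
  assumes cb: "central_basis G n m a c"
  shows "\<exists>lam. is_presentation G (gens n m) (case_sum a c) (rels n m lam)"
proof -
  let ?f = "case_sum a c"
  have a: "\<forall>i<n. a i \<in> carrier G" and cZ: "\<forall>t<m. c t \<in> center G"
    and aa: "\<forall>j<n. \<forall>i<j. comm G (a i) (a j) \<in> range (\<lambda>y. ordprod G c y m)"
    and sp: "spans G (carrier G) (n + m) (append_fun n a c)"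
    and ind: "indep G (n + m) (append_fun n a c)"
    using cb by (auto simp: central_basis_def)
  have c: "\<forall>t<m. c t \<in> carrier G" using cZ center_closed by blast
  have f: "?f ` gens n m \<subseteq> carrier G" using a c by (auto simp: gens_def)
  have "\<forall>i j. \<exists>y. j < n \<longrightarrow> i < j \<longrightarrow> comm G (a i) (a j) = ordprod G c y m" using aa by blast
  then obtain lam where lam: "\<And>i j. j < n \<Longrightarrow> i < j \<Longrightarrow> comm G (a i) (a j) = ordprod G c (lam i j) m"
    by metis
  let ?S = "gens n m" and ?R = "rels n m lam"
  have "comm G (a i) (c t) = \<one>" if "i < n" "t < m" for i t
    using comm_eq_iff[of "a i" "c t" \<one>] a c cZ that centerD[of "c t" "a i"] by simp
  moreover have "comm G (c s) (c t) = \<one>" if "s < m" "t < m" for s t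
    using comm_eq_iff[of "c s" "c t" \<one>] c cZ that centerD[of "c t" "c s"] by simp
  ultimately have hold: "\<forall>(l, r)\<in>?R. eval_word G ?f l = eval_word G ?f r"
    unfolding rels_hold_iff[OF f] using lam by simp
  have nf: "eval_word G ?f (ord_word (gen_seq n) x (n + m)) = ordprod G (append_fun n a c) x (n + m)" for x
    using eval_normal_word[OF f] by simp
  have surj: "eval_word G ?f ` words ?S = carrier G"
  proof
    show "eval_word G ?f ` words ?S \<subseteq> carrier G" using f by auto
    show "carrier G \<subseteq> eval_word G ?f ` words ?S"
    proof
      fix g assume "g \<in> carrier G"
      then obtain x where "g = ordprod G (append_fun n a c) x (n + m)" using spansD(2)[OF sp] by blast
      then show "g \<in> eval_word G ?f ` words ?S"
        using nf ord_word_words[OF gen_seq_gens] by (metis image_eqI)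
    qed
  qed
  \<comment> \<open>In the presented group \<open>w\<close> equals some ordered word. Evaluating
    that word in \<open>G\<close> gives the identity, so by \<open>ind\<close> all exponents vanish
    and the ordered word is empty.\<close>
  have "word_equiv ?S ?R w []" if w: "w \<in> words ?S" and w1: "eval_word G ?f w = \<one>" for w
  proof -
    let ?P = "presented_group ?S ?R" and ?p = "\<lambda>x. word_class ?S ?R [(x, True)]"
    interpret P: group ?P by (rule group_presented_group)
    have p: "?p ` ?S \<subseteq> carrier ?P" by (auto simp: presented_group_carrier)
    have "eval_word ?P ?p l = eval_word ?P ?p r" if "(l, r) \<in> ?R" for l r
    proof -
      have "word_step ?S ?R ([] @ l @ []) ([] @ r @ [])" by (rule word_step.rel[OF that])
      then have "word_equiv ?S ?R l r" using word_step_imp_equiv by fastforce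
      moreover have "l \<in> words ?S" "r \<in> words ?S" using that rels_words by auto
      ultimately show ?thesis by (simp add: presented_group_eval word_class_eq_iff)
    qed
    then have holdP: "\<forall>(l, r)\<in>?R. eval_word ?P ?p l = eval_word ?P ?p r" by blast
    have "carrier ?P \<subseteq> eval_word ?P ?p ` words ?S"
      by (auto simp: presented_group_carrier presented_group_eval image_iff)
    note spP = P.spans_if_rels_hold(2)[OF p holdP this]
    have "word_class ?S ?R w \<in> carrier ?P" using w by (simp add: presented_group_carrier)
    then obtain x where "word_class ?S ?R w =
        ordprod ?P (append_fun n (\<lambda>i. ?p (Inl i)) (\<lambda>t. ?p (Inr t))) x (n + m)"
      using spansD(2)[OF spP] by blast
    also have "\<dots> = eval_word ?P ?p (ord_word (gen_seq n) x (n + m))"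
      using P.eval_normal_word[OF p] by simp
    also have "\<dots> = word_class ?S ?R (ord_word (gen_seq n) x (n + m))"
      by (rule presented_group_eval[OF ord_word_words[OF gen_seq_gens]])
    finally have eq: "word_equiv ?S ?R w (ord_word (gen_seq n) x (n + m))"
      by (simp add: word_class_eq_iff)
    then have "ordprod G (append_fun n a c) x (n + m) = \<one>"
      using eval_word_equiv[OF f rels_words hold eq w] w1 nf by simp
    then have "\<forall>i<n + m. x i = 0" using ind unfolding indep_def by blast
    then show ?thesis using eq ord_word_zero by metis
  qed
  moreover have "eval_word G ?f w = \<one>" if "w \<in> words ?S" "word_equiv ?S ?R w []" for w
    using eval_word_equiv[OF f rels_words hold that(2,1)] by simp
  ultimately have "is_presentation G ?S ?f ?R"
    unfolding is_presentation_def using is_group f rels_words surj by blast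
  then show ?thesis by blast
qed

lemma (in group) has_nilpotent_presentation_iff:
  "has_nilpotent_presentation G n m \<longleftrightarrow> (\<exists>a c. central_basis G n m a c)"
  unfolding has_nilpotent_presentation_def
  using presentation_imp_central_basis central_basis_imp_presentation by blast

theorem theorem4p1:
  fixes G :: "('a, 'b) monoid_scheme"
  assumes "group G"
  shows "(\<forall>n m. has_nilpotent_presentation G n m \<longleftrightarrow>
            (fin_gen G \<and> torsion_free G \<and> two_step_nilpotent G \<and>
             grp_rank (G Mod center G) + grp_rank (G\<lparr>carrier := center G\<rparr>) = n + m \<and>
             grp_rank (G\<lparr>carrier := derived_subgroup G\<rparr>) \<le> m \<and>
             m \<le> grp_rank (G\<lparr>carrier := center G\<rparr>)))
       \<and> (fin_gen G \<and> torsion_free G \<and> two_step_nilpotent G \<longleftrightarrow>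
            (\<exists>n m. has_nilpotent_presentation G n m))"
proof -
  interpret group G by (rule assms)
  have *: "has_nilpotent_presentation G n m \<longleftrightarrow>
      (fin_gen G \<and> torsion_free G \<and> two_step_nilpotent G \<and>
       grp_rank (G Mod center G) + grp_rank (G\<lparr>carrier := center G\<rparr>) = n + m \<and>
       grp_rank (G\<lparr>carrier := derived_subgroup G\<rparr>) \<le> m \<and>
       m \<le> grp_rank (G\<lparr>carrier := center G\<rparr>))" for n m
    unfolding has_nilpotent_presentation_iff
    using central_basis_imp[of n m] imp_central_basis[of n m] by blast
  \<comment> \<open>For the consequence, \<open>n\<close> and \<open>m\<close> are the ranks of
    \<open>G/Z(G)\<close> and of the center; the one condition then left to check is that the
    derived subgroup has at most the rank of the center.\<close>
  have "grp_rank (G\<lparr>carrier := derived_subgroup G\<rparr>) \<le> grp_rank (G\<lparr>carrier := center G\<rparr>)"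
    if fg: "fin_gen G" and ts: "two_step_nilpotent G"
  proof -
    interpret Z: comm_group "G\<lparr>carrier := center G\<rparr>" by (rule center_comm_group)
    obtain k b where "spans G (center G) k b" using center_spanned[OF fg ts] by blast
    then have "fin_gen (G\<lparr>carrier := center G\<rparr>)"
      using Z.spans_imp_fin_gen spans_consistent[OF center_subgroup order_refl] by simp
    then obtain b where "spans G (center G) (grp_rank (G\<lparr>carrier := center G\<rparr>)) b"
      using Z.spans_grp_rank spans_consistent[OF center_subgroup order_refl] by auto
    then show ?thesis
      using central_subgroup_rank_le(1)[OF derived_subgroup_subgroup _ center_subgroup order_refl]
        derived_subset_center[OF ts] by blast
  qed
  then show ?thesis using * by blast
qed

end
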